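(* Let $\mu$ be a probability distribution on $\mathbb{R}^d$ with all exponential moments (i.e. $L_\mu(z)<\infty$ for all $z\in\mathbb{R}^d$), and assume $\inf_{Q}L_\mu>0$. Then there exists $\delta\geq 0$ such that $$\lim_{\substack{d(x)\to\infty\\ x\in Q_\delta}}\rho_x=\inf_Q L_\mu .$$ That is: for every $\epsilon>0$ there is $R$ such that $|\rho_x-\inf_Q L_\mu|<\epsilon$ for all $x\in Q_\delta$ with $d(x)\geq R$; when $I\cup I^\perp=\{1,\ldots,d\}$ (in which case $d(x)=\infty$ for all $x$) this means $\rho_x=\inf_Q L_\mu$ for all $x\in Q_\delta$.
   Context: $\langle\cdot,\cdot\rangle$ is the standard inner product on $\mathbb{R}^d$, $(e_1,\ldots,e_d)$ the standard basis, $x_i$ the $i$th coordinate of $x$. $Q=\{x\in\mathbb{R}^d: x_i\geq 0,\ i=1,\ldots,d\}$ is the positive orthant. For $\delta\ge0$, $Q_\delta=\{x\in\mathbb{R}^d: x_i\geq\delta \text{ for all } i\in\{1,\ldots,d\}\}$. The Laplace transform of $\mu$ is $L_\mu(z)=\int_{\mathbb{R}^d}e^{\langle z,y\rangle}\mu(dy)$. $\mathbb{P}^x_\mu$ is the probability under which $(S_0,S_1,\ldots)$ is a random walk with $S_0=x$ a.s. and independent increments $S_{n+1}-S_n$ of distribution $\mu$. $\tau_Q=\inf\{n\geq1: S_n\notin Q\}$ (with $\inf\emptyset=\infty$), and $$\rho_x=\liminf_{n\to\infty}\mathbb{P}^x_\mu(\tau_Q>n)^{1/n}.$$ Reduced support.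 For $u\in\mathbb{R}^d$ let $u^-=\{x\in\mathbb{R}^d:\langle x,u\rangle\leq0\}$ and $u^\perp=\{x\in\mathbb{R}^d:\langle x,u\rangle=0\}$. An $r$-tuple $(u_1,\ldots,u_r)\in Q^r$ ($r\geq1$) is admissible if (i) $u_1,\ldots,u_r$ are linearly independent, and (ii) $\mu(u_1^-)=1$ and, for $k=2,\ldots,r$, $\mu\big(u_k^-\cap(u_{k-1}^\perp\cap\cdots\cap u_1^\perp)\big)=\mu(u_{k-1}^\perp\cap\cdots\cap u_1^\perp)$. An admissible tuple $(u_1,\ldots,u_r)$ is maximal if there is no $u\in Q$ such that $(u_1,\ldots,u_r,u)$ is admissible. The reduced support of $\mu$ is $V=[u_1,\ldots,u_r]^\perp$, the orthogonal complement of the linear span of any maximal admissible tuple (this span does not depend on the maximal tuple chosen); if there is no admissible tuple, $V=\mathbb{R}^d$. $I=\{i\in\{1,\ldots,d\}: e_i\in V\}$, $I^\perp=\{i\in\{1,\ldots,d\}: e_i\in V^\perp\}$, and for $x\in Q$, $d(x)=\min_{i\notin I\cup I^\perp}x_i$, with the convention $d(x)=\infty$ when $I\cup I^\perp=\{1,\ldots,d\}$. *)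

theory Defs
  imports "HOL-Probability.Probability"
begin

definition orthant :: "(real ^ 'n) set"
  where "orthant = {x. \<forall>i. 0 \<le> x $ i}"

definition shifted_orthant :: "real \<Rightarrow> (real ^ 'n) set"
  where "shifted_orthant \<delta> = {x. \<forall>i. \<delta> \<le> x $ i}"

definition laplace :: "(real ^ 'n) measure \<Rightarrow> real ^ 'n \<Rightarrow> ennreal"
  where "laplace \<mu> z = (\<integral>\<^sup>+ y. ennreal (exp (z \<bullet> y)) \<partial>\<mu>)"


subsection \<open>Random walk and exit time\<close>

text \<open>
  The walk is realised on the space of increment sequences: under the product measure
  \<open>\<Pi>\<^sub>M n\<in>UNIV. \<mu>\<close> the coordinates are independent with law \<open>\<mu>\<close>.
\<close>

definition increments :: "(real ^ 'n) measure \<Rightarrow> (nat \<Rightarrow> real ^ 'n) measure"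
  where "increments \<mu> = (\<Pi>\<^sub>M n\<in>UNIV. \<mu>)"

definition walk :: "real ^ 'n \<Rightarrow> (nat \<Rightarrow> real ^ 'n) \<Rightarrow> nat \<Rightarrow> real ^ 'n"
  where "walk x \<omega> n = x + (\<Sum>k<n. \<omega> k)"

definition exit_time :: "(nat \<Rightarrow> real ^ 'n) \<Rightarrow> enat"
  where "exit_time S = (INF n\<in>{n. 1 \<le> n \<and> S n \<notin> orthant}. enat n)"

definition survival_prob :: "(real ^ 'n) measure \<Rightarrow> real ^ 'n \<Rightarrow> nat \<Rightarrow> real"
  where "survival_prob \<mu> x n =
    measure (increments \<mu>) {\<omega> \<in> space (increments \<mu>). exit_time (walk x \<omega>) > enat n}"

definition rho :: "(real ^ 'n) measure \<Rightarrow> real ^ 'n \<Rightarrow> ereal"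
  where "rho \<mu> x = liminf (\<lambda>n. ereal (root n (survival_prob \<mu> x n)))"


subsection \<open>Reduced support\<close>

definition neg_halfspace :: "real ^ 'n \<Rightarrow> (real ^ 'n) set"
  where "neg_halfspace u = {x. x \<bullet> u \<le> 0}"

definition hyperplane :: "real ^ 'n \<Rightarrow> (real ^ 'n) set"
  where "hyperplane u = {x. x \<bullet> u = 0}"

text \<open>
  Tuples are lists, indexed from 0.  A tuple is linearly independent iff its entries are distinct
  and form an independent set.
\<close>

definition admissible :: "(real ^ 'n) measure \<Rightarrow> (real ^ 'n) list \<Rightarrow> bool"
  where "admissible \<mu> us \<longleftrightarrow>
    us \<noteq> [] \<and> set us \<subseteq> orthant \<and>
    distinct us \<and> independent (set us) \<and>
    measure \<mu> (neg_halfspace (us ! 0)) = 1 \<and>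
    (\<forall>k. 1 \<le> k \<and> k < length us \<longrightarrow>
      measure \<mu> (neg_halfspace (us ! k) \<inter> (\<Inter>j<k. hyperplane (us ! j))) =
      measure \<mu> (\<Inter>j<k. hyperplane (us ! j)))"

definition maximal_admissible :: "(real ^ 'n) measure \<Rightarrow> (real ^ 'n) list \<Rightarrow> bool"
  where "maximal_admissible \<mu> us \<longleftrightarrow>
    admissible \<mu> us \<and> \<not> (\<exists>u\<in>orthant. admissible \<mu> (us @ [u]))"

text \<open>
  The choice of the maximal tuple is immaterial, see \<open>reduced_support_eq\<close> below;
  \<open>exists_maximal_admissible\<close> shows that there is one.
\<close>

definition reduced_support :: "(real ^ 'n) measure \<Rightarrow> (real ^ 'n) set"
  where "reduced_support \<mu> =
    (if \<exists>us. admissible \<mu> us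
     then orthogonal_comp (span (set (SOME us. maximal_admissible \<mu> us)))
     else UNIV)"

lemma exists_maximal_admissible:
  fixes \<mu> :: "(real ^ 'n) measure"
  assumes "admissible \<mu> us"
  shows "\<exists>us. maximal_admissible \<mu> us"
proof -
  have bound: "length vs \<le> DIM(real ^ 'n)" if "admissible \<mu> vs" for vs
  proof -
    have "length vs = card (set vs)" "independent (set vs)"
      using that by (simp_all add: admissible_def distinct_card)
    then show ?thesis
      using independent_bound by metis
  qed
  define n where "n = (GREATEST n. \<exists>vs. admissible \<mu> vs \<and> length vs = n)"
  have "\<exists>vs. admissible \<mu> vs \<and> length vs = n"
    unfolding n_def by (rule GreatestI_nat[where b = "DIM(real ^ 'n)"]) (use assms bound in auto)
  then obtain vs where vs: "admissible \<mu> vs" "length vs = n"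
    by blast
  have "length ws \<le> n" if "admissible \<mu> ws" for ws
    unfolding n_def by (rule Greatest_le_nat[where b = "DIM(real ^ 'n)"]) (use that bound in auto)
  then have "\<not> admissible \<mu> (vs @ [u])" for u
    using vs(2) by fastforce
  with vs(1) show ?thesis
    unfolding maximal_admissible_def by blast
qed

lemma sets_halfspace_hyperplane [measurable]:
  "neg_halfspace u \<in> sets borel" "hyperplane u \<in> sets borel"
proof -
  have "closed (neg_halfspace u)" "closed (hyperplane u)"
    unfolding neg_halfspace_def hyperplane_def
    by (auto intro!: closed_Collect_le closed_Collect_eq continuous_intros)
  then show "neg_halfspace u \<in> sets borel" "hyperplane u \<in> sets borel"
    by auto
qed

lemma admissible_in_span_maximal:
  fixes \<mu> :: "(real ^ 'n) measure"
  assumes "prob_space \<mu>" and sets: "sets \<mu> = sets borel"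
    and us: "maximal_admissible \<mu> us" and vs: "admissible \<mu> vs"
    and k: "k < length vs"
  shows "vs ! k \<in> span (set us)"
  using k
proof (induction k rule: less_induct)
  case (less k)
  interpret prob_space \<mu> by fact
  define P where "P = (\<Inter>j<length us. hyperplane (us ! j))"
  define A where "A = (\<Inter>j<k. hyperplane (vs ! j))"
  define H where "H = neg_halfspace (vs ! k)"
  have adm: "admissible \<mu> us" and max: "\<And>u. u \<in> orthant \<Longrightarrow> \<not> admissible \<mu> (us @ [u])"
    using us by (auto simp: maximal_admissible_def)
  have space: "space \<mu> = UNIV"
    using sets_eq_imp_space_eq[OF sets] by simp
  have meas [measurable]: "P \<in> sets \<mu>" "A \<in> sets \<mu>" "H \<in> sets \<mu>"
    unfolding sets P_def A_def H_def
    by (auto intro!: sets.countable_INT'' sets_halfspace_hyperplane)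
  have "P \<subseteq> A"
  proof
    fix x assume x: "x \<in> P"
    have "orthogonal x v" if "v \<in> span (set us)" for v
      by (rule orthogonal_to_span[OF that])
         (use x in \<open>auto simp: P_def hyperplane_def orthogonal_def in_set_conv_nth\<close>)
    then show "x \<in> A"
      using less by (auto simp: A_def hyperplane_def orthogonal_def)
  qed
  have "measure \<mu> (H \<inter> A) = measure \<mu> A"
  proof (cases "k = 0")
    case True
    then show ?thesis
      using vs space prob_space by (simp add: A_def H_def admissible_def)
  next
    case False
    then show ?thesis
      using vs less.prems by (simp add: A_def H_def admissible_def)
  qed
  then have "measure \<mu> (A - H) = 0"
    using finite_measure_Diff'[of A H] by (simp add: Int_commute)
  moreover have "measure \<mu> (P - H) \<le> measure \<mu> (A - H)"
    by (rule finite_measure_mono) (use \<open>P \<subseteq> A\<close> in auto)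
  ultimately have "measure \<mu> (P - H) = 0"
    by (simp add: measure_le_0_iff)
  then have PH: "measure \<mu> (H \<inter> P) = measure \<mu> P"
    using finite_measure_Diff'[of P H] by (simp add: Int_commute)
  show ?case
  proof (rule ccontr)
    assume notin: "vs ! k \<notin> span (set us)"
    have Q: "vs ! k \<in> orthant"
      using vs less.prems by (auto simp: admissible_def)
    have "independent (insert (vs ! k) (set us))"
      using adm notin by (simp add: admissible_def independent_insertI)
    moreover have "vs ! k \<notin> set us"
      using notin span_base by blast
    moreover have "measure \<mu> (neg_halfspace ((us @ [vs ! k]) ! i) \<inter>
          (\<Inter>j<i. hyperplane ((us @ [vs ! k]) ! j))) =
        measure \<mu> (\<Inter>j<i. hyperplane ((us @ [vs ! k]) ! j))"
      if "1 \<le> i" "i < length (us @ [vs ! k])" for i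
    proof -
      have eq: "(\<Inter>j<i. hyperplane ((us @ [vs ! k]) ! j)) = (\<Inter>j<i. hyperplane (us ! j))"
        using that by (auto simp: nth_append)
      show ?thesis
      proof (cases "i = length us")
        case True
        then show ?thesis
          using PH unfolding eq by (simp add: P_def H_def)
      next
        case False
        then show ?thesis
          using that adm unfolding eq by (simp add: nth_append admissible_def)
      qed
    qed
    ultimately have "admissible \<mu> (us @ [vs ! k])"
      using adm Q by (simp add: admissible_def nth_append)
    with max Q show False
      by blast
  qed
qed

lemma reduced_support_eq:
  fixes \<mu> :: "(real ^ 'n) measure"
  assumes "prob_space \<mu>" "sets \<mu> = sets borel" and us: "maximal_admissible \<mu> us"
  shows "reduced_support \<mu> = orthogonal_comp (span (set us))"
proof -
  define vs where "vs = (SOME vs. maximal_admissible \<mu> vs)"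
  have vs: "maximal_admissible \<mu> vs"
    unfolding vs_def using us by (rule someI)
  have sub: "set as \<subseteq> span (set bs)"
    if "maximal_admissible \<mu> as" "maximal_admissible \<mu> bs" for as bs
    using admissible_in_span_maximal[OF assms(1,2) that(2), of as] that(1)
    by (auto simp: maximal_admissible_def in_set_conv_nth)
  have "span (set us) = span (set vs)"
    using sub[OF us vs] sub[OF vs us] by (simp add: span_eq)
  then show ?thesis
    using us by (auto simp: reduced_support_def vs_def maximal_admissible_def)
qed


subsection \<open>Distance to the relevant part of the boundary\<close>

definition support_axes :: "(real ^ 'n) measure \<Rightarrow> 'n set"
  where "support_axes \<mu> = {i. axis i 1 \<in> reduced_support \<mu>}"

definition orthogonal_axes :: "(real ^ 'n) measure \<Rightarrow> 'n set"
  where "orthogonal_axes \<mu> = {i. axis i 1 \<in> orthogonal_comp (reduced_support \<mu>)}"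

text \<open>The infimum over the empty index set is \<open>\<infinity>\<close>.\<close>

definition boundary_dist :: "(real ^ 'n) measure \<Rightarrow> real ^ 'n \<Rightarrow> ereal"
  where "boundary_dist \<mu> x =
    (INF i\<in>- (support_axes \<mu> \<union> orthogonal_axes \<mu>). ereal (x $ i))"

end

theory Submission
  imports Defs
begin

text \<open>
  The upper bound \<open>\<rho>\<^sub>x \<le> inf\<^sub>Q L\<close> is the exponential Markov inequality.  For the lower bound only the
  steps in the reduced support \<open>V\<close> are kept.  Letting the vectors of a maximal admissible tuple
  tend to infinity one after the other shows that \<open>inf\<^sub>Q L\<close> is at most the infimum over \<open>Q\<close> of the
  Laplace transform of \<open>\<mu>\<close> restricted to \<open>V\<close>; by maximality this restricted transform is coercive
  on the projection of \<open>Q\<close> to \<open>V\<close> and hence attains its minimum at some \<open>z \<in> Q\<close>.  The first-order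
  conditions say that the mean \<open>m\<close> of the step law tilted by \<open>z\<close> lies in \<open>Q\<close> and is orthogonal to
  \<open>z\<close>.  So the tilted walk may follow the line \<open>x + n m\<close>, and the density of the tilt stays bounded
  below along it.  The cost of staying in a ball of radius \<open>R\<close> around the moving centre
  tends to \<open>0\<close> per step as \<open>R \<rightarrow> \<infinity>\<close>, which gives the result for starting points at distance \<open>R\<close>
  from all faces \<open>x\<^sub>i = 0\<close> with \<open>e\<^sub>i \<notin> V\<^sup>\<bottom>\<close>.  Since the coordinates in \<open>I\<close> are only assumed to be at
  least \<open>\<delta>\<close>, the walk is first driven, for a bounded number of steps, by another tilt, the minimiser
  of the transform minus a small multiple of \<open>\<Sum>\<^sub>i\<^sub>\<in>\<^sub>I z\<^sub>i\<close>: its mean has nonnegative coordinates, and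
  positive ones on \<open>I\<close>.  The number \<open>\<delta>\<close> is the radius of a tube for this second tilt, with
  survival rate \<open>1/2\<close>.
\<close>

subsection \<open>Survival probabilities and the upper bound\<close>

locale step_law = prob_space \<mu> for \<mu> :: "(real ^ 'n) measure" +
  assumes sets_step [measurable_cong]: "sets \<mu> = sets borel"
    and laplace_finite: "laplace \<mu> z < \<infinity>"
begin

lemma space_step [simp]: "space \<mu> = UNIV"
  using sets_eq_imp_space_eq[OF sets_step] by simp

end

lemma closed_orthant: "closed (orthant :: (real ^ 'n) set)"
  unfolding orthant_def by (intro closed_Collect_all closed_Collect_le continuous_intros)

lemma orthant_borel [measurable]: "orthant \<in> sets borel"
  by (intro borel_closed closed_orthant)

text \<open>First-step recursion. The starting point itself is not tested, in agreement with
  \<open>exit_time\<close>, which looks only at times from 1 on.\<close>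

primrec survival :: "(real ^ 'n) measure \<Rightarrow> nat \<Rightarrow> real ^ 'n \<Rightarrow> ennreal"
  where
    "survival \<mu> 0 x = 1"
  | "survival \<mu> (Suc n) x = (\<integral>\<^sup>+ y. indicator orthant (x + y) * survival \<mu> n (x + y) \<partial>\<mu>)"

lemma exit_time_greater_iff: "enat n < exit_time S \<longleftrightarrow> (\<forall>k\<in>{1..n}. S k \<in> orthant)"
  \<comment> \<open>Rewriting \<open>enat n < t\<close> as \<open>enat (Suc n) \<le> t\<close> turns
    a strict bound on an infimum into a bound on each of its members.\<close>
  unfolding Suc_ile_eq[symmetric] exit_time_def le_INF_iff
  by (auto simp: Suc_le_eq not_less)

lemma walk_case_nat: "walk x (case_nat y \<omega>) (Suc k) = walk (x + y) \<omega> k"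
  unfolding walk_def sum.lessThan_Suc_shift by (simp add: add.assoc)

context step_law
begin

lemma survival_measurable [measurable]: "survival \<mu> n \<in> borel_measurable borel"
proof (induction n)
  case 0
  then show ?case
    by simp
next
  case (Suc n)
  note [measurable] = Suc
  have "(\<lambda>x. \<integral>\<^sup>+ y. indicator orthant (x + y) * survival \<mu> n (x + y) \<partial>\<mu>) \<in> borel_measurable borel"
    by measurable
  then show ?case
    by simp
qed

section \<open>First-step analysis of the survival probability\<close>

lemma survival_set_measurable:
  "{\<omega> \<in> space (increments \<mu>). \<forall>k\<in>{1..n}. walk x \<omega> k \<in> orthant} \<in> sets (increments \<mu>)"
proof -
  have [measurable]: "(\<lambda>\<omega>. walk x \<omega> k) \<in> borel_measurable (increments \<mu>)" for k
    unfolding walk_def increments_def by measurable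
  show ?thesis
    by measurable
qed

text \<open>Prepending an independent step to an i.i.d. sequence does not change its law
  (\<open>PiM_iter\<close>), so Fubini over the first step reproduces the recursion of
  \<open>survival\<close>.\<close>

lemma emeasure_survival_set:
  "emeasure (increments \<mu>) {\<omega> \<in> space (increments \<mu>). \<forall>k\<in>{1..n}. walk x \<omega> k \<in> orthant} =
    survival \<mu> n x"
proof (induction n arbitrary: x)
  case 0
  interpret sequence_space \<mu> ..
  show ?case
    using P.emeasure_space_1 by (simp add: increments_def)
next
  case (Suc n)
  interpret sequence_space \<mu> ..
  define A where "A n x = {\<omega> \<in> space S. \<forall>k\<in>{1..n}. walk x \<omega> k \<in> orthant}" for n x
  have A [measurable]: "A n x \<in> sets S" for n x
    using survival_set_measurable[of n x] by (simp add: A_def increments_def)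
  have "emeasure S (A (Suc n) x) =
      emeasure (distr (\<mu> \<Otimes>\<^sub>M S) S (\<lambda>(s, \<omega>). case_nat s \<omega>)) (A (Suc n) x)"
    by (simp add: PiM_iter)
  also have "\<dots> = emeasure (\<mu> \<Otimes>\<^sub>M S) ((\<lambda>(s, \<omega>). case_nat s \<omega>) -` A (Suc n) x \<inter> space (\<mu> \<Otimes>\<^sub>M S))"
    by (rule emeasure_distr) auto
  also have "\<dots> = (\<integral>\<^sup>+ y. emeasure S (Pair y -` ((\<lambda>(s, \<omega>). case_nat s \<omega>) -` A (Suc n) x \<inter>
      space (\<mu> \<Otimes>\<^sub>M S))) \<partial>\<mu>)"
    by (rule P.emeasure_pair_measure_alt) measurable
  also have "\<dots> = (\<integral>\<^sup>+ y. indicator orthant (x + y) * survival \<mu> n (x + y) \<partial>\<mu>)"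
  proof (rule nn_integral_cong)
    fix y
    have all: "(\<forall>k\<in>{1..Suc n}. P k) \<longleftrightarrow> P 1 \<and> (\<forall>k\<in>{1..n}. P (Suc k))" for P
      by (auto simp: Ball_def) (metis One_nat_def Suc_le_mono Suc_pred le_SucE less_Suc_eq_0_disj
            less_Suc_eq_le not_less_eq_eq zero_less_Suc)
    have "(\<forall>k\<in>{1..Suc n}. walk x (case_nat y \<omega>) k \<in> orthant) \<longleftrightarrow>
        x + y \<in> orthant \<and> (\<forall>k\<in>{1..n}. walk (x + y) \<omega> k \<in> orthant)" for \<omega>
      unfolding all unfolding One_nat_def walk_case_nat by (simp add: walk_def)
    then have "Pair y -` ((\<lambda>(s, \<omega>). case_nat s \<omega>) -` A (Suc n) x \<inter> space (\<mu> \<Otimes>\<^sub>M S)) =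
        (if x + y \<in> orthant then A n (x + y) else {})"
      unfolding A_def by (auto simp: space_pair_measure space_PiM PiE_iff split: nat.split)
    then show "emeasure S (Pair y -` ((\<lambda>(s, \<omega>). case_nat s \<omega>) -` A (Suc n) x \<inter> space (\<mu> \<Otimes>\<^sub>M S))) =
        indicator orthant (x + y) * survival \<mu> n (x + y)"
      using Suc.IH[of "x + y"] by (simp add: A_def increments_def)
  qed
  finally show ?case
    by (simp add: A_def increments_def)
qed

lemma survival_prob_eq: "ennreal (survival_prob \<mu> x n) = survival \<mu> n x"
proof -
  interpret sequence_space \<mu> ..
  interpret S: prob_space "increments \<mu>"
    unfolding increments_def by (intro prob_space_PiM prob_space_axioms)
  show ?thesis
    unfolding survival_prob_def exit_time_greater_iff S.emeasure_eq_measure[symmetric]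
    by (rule emeasure_survival_set)
qed

section \<open>Bounds on the exponential rate\<close>

lemma survival_prob_nonneg: "0 \<le> survival_prob \<mu> x n"
  by (simp add: survival_prob_def)

text \<open>Exponential Markov inequality by induction: \<open>exp (z \<bullet> x)\<close> is at
  least 1 on the orthant, and each step multiplies its expectation by
  \<open>laplace \<mu> z\<close>.\<close>

lemma survival_le:
  assumes z: "z \<in> orthant" and x: "x \<in> orthant"
  shows "survival \<mu> n x \<le> ennreal (exp (z \<bullet> x)) * laplace \<mu> z ^ n"
  using x
proof (induction n arbitrary: x)
  case 0
  have "0 \<le> z \<bullet> x"
    using z 0 unfolding inner_vec_def orthant_def by (auto intro!: sum_nonneg)
  then show ?case
    by simp
next
  case (Suc n)
  have "survival \<mu> (Suc n) x \<le>
      (\<integral>\<^sup>+ y. (ennreal (exp (z \<bullet> x)) * laplace \<mu> z ^ n) * ennreal (exp (z \<bullet> y)) \<partial>\<mu>)"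
    unfolding survival.simps
  proof (rule nn_integral_mono)
    fix y
    show "indicator orthant (x + y) * survival \<mu> n (x + y) \<le>
        (ennreal (exp (z \<bullet> x)) * laplace \<mu> z ^ n) * ennreal (exp (z \<bullet> y))"
    proof (cases "x + y \<in> orthant")
      case True
      then show ?thesis
        using Suc.IH[OF True] by (simp add: inner_add_right exp_add ennreal_mult mult_ac)
    qed simp
  qed
  also have "\<dots> = ennreal (exp (z \<bullet> x)) * laplace \<mu> z ^ n * laplace \<mu> z"
    unfolding laplace_def by (rule nn_integral_cmult) measurable
  finally show ?case
    by (simp add: mult_ac)
qed

lemma rho_le_laplace:
  assumes z: "z \<in> orthant" and x: "x \<in> orthant"
  shows "rho \<mu> x \<le> enn2ereal (laplace \<mu> z)"
proof -
  obtain L where L: "laplace \<mu> z = ennreal L" "0 \<le> L"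
    using laplace_finite[of z] by (cases "laplace \<mu> z") auto
  have le: "survival_prob \<mu> x n \<le> exp (z \<bullet> x) * L ^ n" for n
  proof -
    have "ennreal (survival_prob \<mu> x n) \<le> ennreal (exp (z \<bullet> x) * L ^ n)"
      unfolding survival_prob_eq using survival_le[OF z x, of n] L
      by (simp add: ennreal_mult ennreal_power)
    then show ?thesis
      using L by (simp add: ennreal_le_iff)
  qed
  have root: "root n (survival_prob \<mu> x n) \<le> root n (exp (z \<bullet> x)) * L" if "0 < n" for n
  proof -
    have "root n (survival_prob \<mu> x n) \<le> root n (exp (z \<bullet> x) * L ^ n)"
      using that le by simp
    then show ?thesis
      using that L by (simp add: real_root_mult real_root_power_cancel)
  qed
  have "rho \<mu> x \<le> liminf (\<lambda>n. ereal (root n (exp (z \<bullet> x)) * L))"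
    unfolding rho_def
    by (rule Liminf_mono) (use root in \<open>auto intro!: eventually_sequentiallyI[of 1]\<close>)
  also have "\<dots> = ereal (1 * L)"
    by (intro lim_imp_Liminf tendsto_ereal tendsto_mult tendsto_const LIMSEQ_root_const) auto
  finally show ?thesis
    using L by (simp add: enn2ereal_ennreal)
qed

lemma rho_nonneg: "0 \<le> rho \<mu> x"
  unfolding rho_def
  by (intro Liminf_bounded always_eventually allI) (simp add: survival_prob_nonneg real_root_ge_zero)

lemma rho_le_INF_laplace:
  assumes x: "x \<in> orthant"
  shows "rho \<mu> x \<le> enn2ereal (INF z\<in>orthant. laplace \<mu> z)"
proof -
  \<comment> \<open>The infimum lives in \<open>ennreal\<close>, so the comparison is made there;
    \<open>rho_nonneg\<close> makes the conversion lossless.\<close>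
  have "e2ennreal (rho \<mu> x) \<le> (INF z\<in>orthant. laplace \<mu> z)"
  proof (rule INF_greatest)
    fix z :: "real ^ 'n" assume "z \<in> orthant"
    then show "e2ennreal (rho \<mu> x) \<le> laplace \<mu> z"
      using e2ennreal_mono[OF rho_le_laplace[OF _ x]] by simp
  qed
  then show ?thesis
    using rho_nonneg[of x] by (metis enn2ereal_e2ennreal less_eq_ennreal.rep_eq)
qed

text \<open>A delay of \<open>N\<close> steps only changes the constant to \<open>C / q ^ N\<close>,
  whose \<open>n\<close>-th root tends to 1.\<close>

lemma rho_ge:
  assumes C: "0 < C" and q: "0 \<le> q" and le: "\<And>n. ennreal (C * q ^ n) \<le> survival \<mu> (N + n) x"
  shows "ereal q \<le> rho \<mu> x"
proof (cases "q = 0")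
  case True
  then show ?thesis
    using rho_nonneg by (simp add: zero_ereal_def)
next
  case False
  define D where "D = C / q ^ N"
  have D: "0 < D" "0 < q"
    using C q False by (auto simp: D_def)
  have "root n D * q \<le> root n (survival_prob \<mu> x n)" if "N < n" for n
  proof -
    have "ennreal (D * q ^ n) \<le> survival \<mu> n x"
      using le[of "n - N"] that D by (simp add: D_def power_diff)
    then have "D * q ^ n \<le> survival_prob \<mu> x n"
      unfolding survival_prob_eq[symmetric] by (simp add: survival_prob_nonneg)
    then have "root n (D * q ^ n) \<le> root n (survival_prob \<mu> x n)"
      using that by simp
    then show ?thesis
      using that D by (simp add: real_root_mult real_root_power_cancel)
  qed
  then have "liminf (\<lambda>n. ereal (root n D * q)) \<le> rho \<mu> x"
    unfolding rho_def
    by (intro Liminf_mono eventually_sequentiallyI[of "Suc N"]) auto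
  moreover have "liminf (\<lambda>n. ereal (root n D * q)) = ereal (1 * q)"
    using D by (intro lim_imp_Liminf tendsto_ereal tendsto_mult tendsto_const LIMSEQ_root_const) auto
  ultimately show ?thesis
    by simp
qed

end

subsection \<open>Centred steps stay in a large ball at small cost\<close>

lemma norm_le_quadratic: "norm y \<le> 1 + (norm y)\<^sup>2"
proof -
  have "0 \<le> (norm y - 1)\<^sup>2"
    by simp
  then have "2 * norm y \<le> 1 + (norm y)\<^sup>2"
    by (simp add: power2_diff)
  then show ?thesis
    using norm_ge_zero[of y] by linarith
qed

text \<open>The expected positive part is positively homogeneous and Lipschitz in \<open>u\<close>,
  and positive on \<open>K\<close> away from 0; its minimum over the compact set
  \<open>K \<inter> sphere 0 1\<close> serves as \<open>c\<close>. It is used for fluctuations, with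
  \<open>K\<close> a subspace, and for coercivity, with \<open>K\<close> the projected
  orthant.\<close>

lemma positive_part_lower_bound:
  fixes Y :: "'a \<Rightarrow> 'b :: euclidean_space"
  assumes int: "integrable M Y"
    and K: "closed K" "\<And>u c. u \<in> K \<Longrightarrow> 0 \<le> c \<Longrightarrow> c *\<^sub>R u \<in> K"
    and pos: "\<And>u. u \<in> K \<Longrightarrow> u \<noteq> 0 \<Longrightarrow> \<not> (AE \<omega> in M. u \<bullet> Y \<omega> \<le> 0)"
  obtains c where "0 < c" "\<And>u. u \<in> K \<Longrightarrow> c * norm u \<le> (\<integral>\<omega>. max 0 (u \<bullet> Y \<omega>) \<partial>M)"
proof -
  define g where "g u = (\<integral>\<omega>. max 0 (u \<bullet> Y \<omega>) \<partial>M)" for u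
  have int_g: "integrable M (\<lambda>\<omega>. max 0 (u \<bullet> Y \<omega>))" for u
    using int by (intro integrable_max) auto
  have g_pos: "0 < g u" if "u \<in> K" "u \<noteq> 0" for u
  proof -
    have "g u \<noteq> 0"
    proof
      assume "g u = 0"
      then have "AE \<omega> in M. max 0 (u \<bullet> Y \<omega>) = 0"
        using integral_nonneg_eq_0_iff_AE[OF int_g] by (auto simp: g_def)
      then have "AE \<omega> in M. u \<bullet> Y \<omega> \<le> 0"
        by eventually_elim (auto simp: max_def split: if_splits)
      with pos[OF that] show False
        by blast
    qed
    moreover have "0 \<le> g u"
      unfolding g_def by (intro integral_nonneg_AE) auto
    ultimately show ?thesis
      by simp
  qed
  define B where "B = (\<integral>\<omega>. norm (Y \<omega>) \<partial>M)"
  have le: "g u \<le> g v + B * dist u v" for u v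
  proof -
    have "g u \<le> (\<integral>\<omega>. max 0 (v \<bullet> Y \<omega>) + norm (Y \<omega>) * dist u v \<partial>M)"
      unfolding g_def
    proof (rule integral_mono)
      show "integrable M (\<lambda>\<omega>. max 0 (v \<bullet> Y \<omega>) + norm (Y \<omega>) * dist u v)"
        by (intro Bochner_Integration.integrable_add int_g integrable_mult_left integrable_norm int)
      fix \<omega>
      have "u \<bullet> Y \<omega> = v \<bullet> Y \<omega> + (u - v) \<bullet> Y \<omega>"
        by (simp add: inner_diff_left)
      also have "(u - v) \<bullet> Y \<omega> \<le> norm (Y \<omega>) * dist u v"
        using norm_cauchy_schwarz[of "u - v" "Y \<omega>"] by (simp add: dist_norm mult.commute)
      finally have "u \<bullet> Y \<omega> \<le> v \<bullet> Y \<omega> + norm (Y \<omega>) * dist u v"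
        by simp
      moreover have "0 \<le> norm (Y \<omega>) * dist u v"
        by simp
      ultimately show "max 0 (u \<bullet> Y \<omega>) \<le> max 0 (v \<bullet> Y \<omega>) + norm (Y \<omega>) * dist u v"
        by linarith
    qed (rule int_g)
    also have "\<dots> = g v + B * dist u v"
      unfolding g_def B_def using int
      by (subst Bochner_Integration.integral_add) (auto intro!: int_g)
    finally show ?thesis .
  qed
  have B: "0 \<le> B"
    unfolding B_def by (intro integral_nonneg_AE) auto
  have "B-lipschitz_on (K \<inter> sphere 0 1) g"
  proof (rule lipschitz_onI[OF _ B])
    fix u v
    show "dist (g u) (g v) \<le> B * dist u v"
      using le[of u v] le[of v u] by (simp add: dist_real_def dist_commute abs_le_iff)
  qed
  then have cont: "continuous_on (K \<inter> sphere 0 1) g"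
    by (rule lipschitz_on_continuous_on)
  obtain c where c: "0 < c" "\<And>u. u \<in> K \<inter> sphere 0 1 \<Longrightarrow> c \<le> g u"
  proof (cases "K \<inter> sphere 0 1 = {}")
    case True
    then show ?thesis
      using that[of 1] by auto
  next
    case False
    have "compact (K \<inter> sphere 0 1)"
      using K(1) by (simp add: closed_Int_compact)
    from continuous_attains_inf[OF this False cont] obtain u
      where "u \<in> K \<inter> sphere 0 1" "\<And>v. v \<in> K \<inter> sphere 0 1 \<Longrightarrow> g u \<le> g v"
      by blast
    then show ?thesis
      using that[of "g u"] g_pos[of u] by fastforce
  qed
  have "c * norm u \<le> g u" if "u \<in> K" for u
  proof (cases "u = 0")
    case False
    define v where "v = (1 / norm u) *\<^sub>R u"
    have v: "v \<in> K \<inter> sphere 0 1"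
      using that False K(2)[of u "1 / norm u"] by (simp add: v_def)
    have "g u = (\<integral>\<omega>. norm u * max 0 (v \<bullet> Y \<omega>) \<partial>M)"
      unfolding g_def
      by (rule Bochner_Integration.integral_cong[OF refl])
         (use False in \<open>auto simp: v_def max_def zero_le_divide_iff\<close>)
    then have "g u = norm u * g v"
      by (simp add: g_def)
    with c(2)[OF v] show ?thesis
      by (metis mult.commute mult_left_mono norm_ge_zero)
  qed (simp add: g_def)
  with c(1) that show thesis
    unfolding g_def by blast
qed

text \<open>Here \<open>a\<close> will be the current value of
  \<open>1 - (norm s)\<^sup>2 / R\<^sup>2\<close> and \<open>b\<close> its increment. The second
  bound linearises the gain \<open>(max 0 b)\<^sup>2\<close> by
  \<open>0 \<le> (max 0 b - \<kappa>)\<^sup>2\<close>, so that a lower bound on the mean of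
  \<open>max 0 b\<close> is enough.\<close>

lemma positive_part_square_ge:
  fixes a b \<kappa> :: real
  assumes "0 \<le> a"
  shows "a\<^sup>2 + 2 * a * b \<le> (max 0 (a + b))\<^sup>2"
    and "a\<^sup>2 + 2 * a * b + 2 * \<kappa> * max 0 b - \<kappa>\<^sup>2 \<le> (max 0 (a + b))\<^sup>2"
proof -
  have *: "a\<^sup>2 + 2 * a * b + (max 0 b)\<^sup>2 \<le> (max 0 (a + b))\<^sup>2"
  proof (cases "0 \<le> b")
    case True
    then show ?thesis
      using assms by (simp add: max_def power2_eq_square algebra_simps)
  next
    case False
    have "a * (a + 2 * b) \<le> (max 0 (a + b))\<^sup>2"
    proof (cases "0 \<le> a + b")
      case True
      then show ?thesis
        using assms by (simp add: max_def power2_eq_square algebra_simps)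
    next
      case neg: False
      then have "a * (a + 2 * b) \<le> 0"
        using assms False by (intro mult_nonneg_nonpos) auto
      then show ?thesis
        using neg by simp
    qed
    then show ?thesis
      using False by (simp add: power2_eq_square algebra_simps)
  qed
  then show "a\<^sup>2 + 2 * a * b \<le> (max 0 (a + b))\<^sup>2"
    using zero_le_power2[of "max 0 b"] by linarith
  have "0 \<le> (max 0 b - \<kappa>)\<^sup>2"
    by simp
  then show "a\<^sup>2 + 2 * a * b + 2 * \<kappa> * max 0 b - \<kappa>\<^sup>2 \<le> (max 0 (a + b))\<^sup>2"
    using * by (simp add: power2_diff mult_ac)
qed

text \<open>
  If \<open>f\<close> is nonnegative, supported in a ball, and the expectation of \<open>f (s + Y)\<close> is at least
  \<open>(1 - \<epsilon>) f s\<close>, then the walk with steps \<open>Y\<close> survives \<open>n\<close> steps in the ball with probability at least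
  \<open>(1 - \<epsilon>)\<^sup>n f s / sup f\<close>.  The witness is \<open>f s = (max 0 (1 - |s|\<^sup>2 / R\<^sup>2))\<^sup>2\<close> on the span \<open>D\<close> of the
  support of \<open>Y\<close>.  With \<open>a = 1 - |s|\<^sup>2 / R\<^sup>2\<close>, the drift of \<open>a\<close> costs \<open>2 a v / R\<^sup>2\<close>, where \<open>v\<close> is the
  second moment of \<open>|Y|\<close>.  This is at most \<open>\<epsilon> a\<^sup>2\<close> unless \<open>a\<close> is small, and then it is outweighed by
  the radial fluctuations, which contribute \<open>c\<^sup>2 / (4 R\<^sup>2)\<close>.
\<close>

lemma (in prob_space) almost_eigenfunction:
  fixes Y :: "'a \<Rightarrow> 'b :: euclidean_space"
  assumes Y [measurable]: "Y \<in> borel_measurable M"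
    and sq: "integrable M (\<lambda>\<omega>. (norm (Y \<omega>))\<^sup>2)"
    and centered: "expectation Y = 0"
    and V: "subspace V" "AE \<omega> in M. Y \<omega> \<in> V"
    and \<epsilon>: "0 < \<epsilon>"
  obtains R :: real and f :: "'b \<Rightarrow> real"
  where "0 < R" "f \<in> borel_measurable borel" "\<And>s. 0 \<le> f s" "\<And>s. f s \<le> 1" "f 0 = 1"
    "\<And>s. f s \<noteq> 0 \<Longrightarrow> s \<in> V \<and> norm s \<le> R"
    "\<And>s. (1 - \<epsilon>) * f s \<le> expectation (\<lambda>\<omega>. f (s + Y \<omega>))"
proof -
  have int: "integrable M Y"
  proof (rule Bochner_Integration.integrable_bound[OF Bochner_Integration.integrable_add[OF sq integrable_const[of 1]]])
    show "AE \<omega> in M. norm (Y \<omega>) \<le> norm ((norm (Y \<omega>))\<^sup>2 + 1)"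
      using norm_le_quadratic by (intro AE_I2) (simp add: add.commute)
  qed fact
  have zero: "expectation (\<lambda>\<omega>. u \<bullet> Y \<omega>) = 0" for u
    using int centered by simp
  \<comment> \<open>The directions in which \<open>Y\<close> is degenerate; \<open>D\<close> is then
    the subspace on which \<open>Y\<close> fluctuates in every direction.\<close>
  define N where "N = {u. AE \<omega> in M. u \<bullet> Y \<omega> = 0}"
  define D where "D = orthogonal_comp N"
  have subN: "subspace N"
    unfolding N_def
  proof (rule subspaceI)
    fix x y assume "x \<in> {u. AE \<omega> in M. u \<bullet> Y \<omega> = 0}" "y \<in> {u. AE \<omega> in M. u \<bullet> Y \<omega> = 0}"
    then have "AE \<omega> in M. x \<bullet> Y \<omega> = 0" "AE \<omega> in M. y \<bullet> Y \<omega> = 0"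
      by auto
    then have "AE \<omega> in M. (x + y) \<bullet> Y \<omega> = 0"
      by eventually_elim (simp add: inner_add_left)
    then show "x + y \<in> {u. AE \<omega> in M. u \<bullet> Y \<omega> = 0}"
      by simp
  qed auto
  have subD: "subspace D"
    unfolding D_def by (rule subspace_orthogonal_comp)
  have [measurable]: "D \<in> sets borel"
    by (intro borel_closed closed_subspace subD)
  have DV: "D \<subseteq> V"
  proof -
    have "orthogonal_comp V \<subseteq> N"
    proof
      fix u assume "u \<in> orthogonal_comp V"
      then have "y \<in> V \<Longrightarrow> u \<bullet> y = 0" for y
        by (auto simp: orthogonal_comp_def orthogonal_def inner_commute)
      with V(2) show "u \<in> N"
        unfolding N_def by auto
    qed
    then have "D \<subseteq> orthogonal_comp (orthogonal_comp V)"
      unfolding D_def by (rule orthogonal_comp_anti_mono)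
    with orthogonal_comp_self[OF V(1)] show ?thesis
      by simp
  qed
  have YD: "AE \<omega> in M. Y \<omega> \<in> D"
  proof -
    \<comment> \<open>A finite basis of \<open>N\<close> gives one exceptional null set for all
      directions at once.\<close>
    obtain B where B: "B \<subseteq> N" "independent B" "N \<subseteq> span B"
      using basis_exists[of N] by metis
    have "AE \<omega> in M. \<forall>b\<in>B. b \<bullet> Y \<omega> = 0"
      using B by (subst AE_finite_all) (auto simp: N_def independent_imp_finite)
    then show ?thesis
    proof eventually_elim
      case (elim \<omega>)
      have "orthogonal (Y \<omega>) u" if "u \<in> N" for u
        by (rule orthogonal_to_span[of _ B])
           (use that B elim in \<open>auto simp: orthogonal_def inner_commute\<close>)
      then show ?case
        by (auto simp: D_def orthogonal_comp_def orthogonal_commute)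
    qed
  qed
  obtain c where c: "0 < c" "\<And>u. u \<in> D \<Longrightarrow> c * norm u \<le> expectation (\<lambda>\<omega>. max 0 (u \<bullet> Y \<omega>))"
  proof (rule positive_part_lower_bound[OF int, of D])
    show "closed D"
      by (intro closed_subspace subD)
    show "c *\<^sub>R u \<in> D" if "u \<in> D" for u c
      using that subD by (simp add: subspace_scale)
    show "\<not> (AE \<omega> in M. u \<bullet> Y \<omega> \<le> 0)" if u: "u \<in> D" "u \<noteq> 0" for u
    proof
      assume le: "AE \<omega> in M. u \<bullet> Y \<omega> \<le> 0"
      \<comment> \<open>A nonnegative variable of mean 0 vanishes almost surely; this is where
        centring enters.\<close>
      have "AE \<omega> in M. - (u \<bullet> Y \<omega>) = 0"
        using le zero[of u] int
        by (subst integral_nonneg_eq_0_iff_AE[symmetric]) auto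
      then have "u \<in> N"
        by (simp add: N_def)
      with u show False
        by (auto simp: D_def orthogonal_comp_def orthogonal_def)
    qed
  qed (rule that)
  define v where "v = expectation (\<lambda>\<omega>. (norm (Y \<omega>))\<^sup>2)"
  have v: "0 \<le> v"
    unfolding v_def by (intro integral_nonneg_AE) auto
  \<comment> \<open>The last three summands are made for \<open>Rc\<close>, \<open>R3\<close> and
    \<open>R4\<close> in turn; the summand 1 gives \<open>R \<le> R\<^sup>2\<close>.\<close>
  define R where "R = 1 + 2 * v / c + 16 * v\<^sup>2 / (\<epsilon> * c\<^sup>2) + 3 * v / \<epsilon>"
  have summands: "0 \<le> 2 * v / c" "0 \<le> 16 * v\<^sup>2 / (\<epsilon> * c\<^sup>2)" "0 \<le> 3 * v / \<epsilon>"
    using v c(1) \<epsilon> by auto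
  then have R1: "1 \<le> R"
    unfolding R_def by linarith
  then have R2: "R \<le> R\<^sup>2"
    by (simp add: power2_eq_square)
  have Rc: "2 * v \<le> c * R"
  proof -
    have "2 * v / c \<le> R"
      unfolding R_def using summands by linarith
    then show ?thesis
      using c(1) by (simp add: field_simps)
  qed
  have R3: "16 * v\<^sup>2 \<le> \<epsilon> * c\<^sup>2 * R\<^sup>2"
  proof -
    have "16 * v\<^sup>2 / (\<epsilon> * c\<^sup>2) \<le> R\<^sup>2"
      using summands R2 unfolding R_def by linarith
    then show ?thesis
      using c(1) \<epsilon> by (simp add: pos_divide_le_eq mult_ac)
  qed
  have R4: "3 * v \<le> \<epsilon> * R\<^sup>2"
  proof -
    have "3 * v / \<epsilon> \<le> R\<^sup>2"
      using summands R2 unfolding R_def by linarith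
    then show ?thesis
      using \<epsilon> by (simp add: pos_divide_le_eq mult_ac)
  qed
  define f where "f s = (if s \<in> D then (max 0 (1 - (norm s)\<^sup>2 / R\<^sup>2))\<^sup>2 else 0)" for s
  have meas [measurable]: "f \<in> borel_measurable borel"
    unfolding f_def by measurable
  have f01: "0 \<le> f s" "f s \<le> 1" for s
    using R1 by (auto simp: f_def max_def power_le_one)
  have outside: "f s = 0" if "R \<le> norm s" for s
  proof -
    have "R\<^sup>2 \<le> (norm s)\<^sup>2"
      using that R1 by (intro power_mono) auto
    then show ?thesis
      using R1 by (simp add: f_def max_def)
  qed
  have step: "(1 - \<epsilon>) * f s \<le> expectation (\<lambda>\<omega>. f (s + Y \<omega>))" for s
  proof (cases "s \<in> D \<and> norm s < R")
    case False
    then have "f s = 0"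
      using outside[of s] by (auto simp: f_def)
    then show ?thesis
      by (simp add: integral_nonneg_AE f01)
  next
    case True
    define a where "a = 1 - (norm s)\<^sup>2 / R\<^sup>2"
    define b where "b \<omega> = (- 2 * (s \<bullet> Y \<omega>) - (norm (Y \<omega>))\<^sup>2) / R\<^sup>2" for \<omega>
    have "(norm s)\<^sup>2 \<le> R\<^sup>2"
      using True by (intro power_mono) auto
    then have a: "0 \<le> a" "a \<le> 1" and fs: "f s = a\<^sup>2"
      using True R1 by (auto simp: a_def f_def field_simps)
    have fY: "AE \<omega> in M. f (s + Y \<omega>) = (max 0 (a + b \<omega>))\<^sup>2"
      using YD
    proof eventually_elim
      case (elim \<omega>)
      have "1 - (norm (s + Y \<omega>))\<^sup>2 / R\<^sup>2 = a + b \<omega>"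
        by (simp add: a_def b_def power2_norm_eq_inner inner_add_left inner_add_right inner_commute
            diff_divide_distrib add_divide_distrib)
      then show ?case
        using elim True subD by (simp add: f_def subspace_add)
    qed
    have int_b [intro]: "integrable M b"
      unfolding b_def using int sq by auto
    have Eb: "expectation b = - v / R\<^sup>2"
      unfolding b_def using int sq zero by (simp add: v_def)
    have int_f [intro]: "integrable M (\<lambda>\<omega>. f (s + Y \<omega>))"
      by (rule integrable_const_bound[where B = 1]) (use f01 in auto)
    have E1: "a\<^sup>2 - 2 * a * v / R\<^sup>2 \<le> expectation (\<lambda>\<omega>. f (s + Y \<omega>))"
    proof -
      have "expectation (\<lambda>\<omega>. a\<^sup>2 + 2 * a * b \<omega>) \<le> expectation (\<lambda>\<omega>. f (s + Y \<omega>))"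
      proof (rule integral_mono_AE)
        show "AE \<omega> in M. a\<^sup>2 + 2 * a * b \<omega> \<le> f (s + Y \<omega>)"
          using fY by eventually_elim (simp add: positive_part_square_ge a)
      qed (intro int_f Bochner_Integration.integrable_add integrable_const integrable_mult_right int_b)+
      also have "expectation (\<lambda>\<omega>. a\<^sup>2 + 2 * a * b \<omega>) = a\<^sup>2 - 2 * a * v / R\<^sup>2"
        using int_b by (simp add: Eb prob_space)
      finally show ?thesis .
    qed
    show ?thesis
    proof (cases "norm s < R / 2")
      case True
      have "(norm s)\<^sup>2 \<le> (R / 2)\<^sup>2"
        using True by (intro power_mono) auto
      then have "3 / 4 \<le> a"
        using R1 by (simp add: a_def field_simps power2_eq_square)
      have "2 * v \<le> \<epsilon> * R\<^sup>2 * (3 / 4)"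
        using R4 v by linarith
      also have "\<dots> \<le> \<epsilon> * R\<^sup>2 * a"
        using \<open>3 / 4 \<le> a\<close> \<epsilon> by (intro mult_left_mono) auto
      finally have "a * (2 * v) \<le> a * (\<epsilon> * R\<^sup>2 * a)"
        using a by (intro mult_left_mono)
      then have "2 * a * v / R\<^sup>2 \<le> \<epsilon> * a\<^sup>2"
        using R1 by (simp add: pos_divide_le_eq power2_eq_square mult_ac)
      then show ?thesis
        using E1 unfolding fs by (simp add: algebra_simps)
    next
      case far: False
      \<comment> \<open>A lower bound for the mean of \<open>h\<close>. Taking it as
        \<open>\<kappa>\<close> in \<open>positive_part_square_ge\<close> leaves the gain
        \<open>2 * k * expectation h - k\<^sup>2\<close>, which is at least
        \<open>k\<^sup>2\<close>.\<close>
      define k where "k = c / (2 * R)"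
      have k: "0 \<le> k"
        using c R1 by (simp add: k_def)
      \<comment> \<open>A minorant of \<open>max 0 (b \<omega>)\<close> that separates the inward
        radial fluctuation, controlled by \<open>c\<close>, from the second moment.\<close>
      define h where "h \<omega> = (2 * max 0 ((- s) \<bullet> Y \<omega>) - (norm (Y \<omega>))\<^sup>2) / R\<^sup>2" for \<omega>
      have int_m: "integrable M (\<lambda>\<omega>. max 0 ((- s) \<bullet> Y \<omega>))"
        using int by (intro integrable_max) auto
      have int_h [intro]: "integrable M h"
        unfolding h_def using sq int_m by auto
      have hb: "h \<omega> \<le> max 0 (b \<omega>)" for \<omega>
        using R1 unfolding h_def b_def by (auto simp: max_def field_simps)
      have Eh: "k \<le> expectation h"
      proof -
        have "c * R \<le> 2 * (c * norm (- s))"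
          using far c by simp
        also have "c * norm (- s) \<le> expectation (\<lambda>\<omega>. max 0 ((- s) \<bullet> Y \<omega>))"
          using True subD by (intro c(2)) (simp add: subspace_neg)
        finally have le: "c * R / 2 \<le> 2 * expectation (\<lambda>\<omega>. max 0 ((- s) \<bullet> Y \<omega>)) - v"
          using Rc by linarith
        have Eh: "expectation h = (2 * expectation (\<lambda>\<omega>. max 0 ((- s) \<bullet> Y \<omega>)) - v) / R\<^sup>2"
          unfolding h_def v_def using sq int_m
          by (simp del: inner_minus_left)
        have k: "k = (c * R / 2) / R\<^sup>2"
          using R1 by (simp add: k_def power2_eq_square)
        show ?thesis
          unfolding Eh k by (rule divide_right_mono[OF le]) simp
      qed
      have "expectation (\<lambda>\<omega>. a\<^sup>2 + 2 * a * b \<omega> + 2 * k * h \<omega> - k\<^sup>2) \<le> expectation (\<lambda>\<omega>. f (s + Y \<omega>))"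
      proof (rule integral_mono_AE)
        show "AE \<omega> in M. a\<^sup>2 + 2 * a * b \<omega> + 2 * k * h \<omega> - k\<^sup>2 \<le> f (s + Y \<omega>)"
          using fY
        proof eventually_elim
          case (elim \<omega>)
          have "2 * k * h \<omega> \<le> 2 * k * max 0 (b \<omega>)"
            using hb k by (intro mult_left_mono) auto
          then show ?case
            using positive_part_square_ge(2)[OF a(1), of "b \<omega>" k] elim by linarith
        qed
      qed (intro int_f Bochner_Integration.integrable_add Bochner_Integration.integrable_diff
          integrable_const integrable_mult_right int_b int_h)+
      also have "expectation (\<lambda>\<omega>. a\<^sup>2 + 2 * a * b \<omega> + 2 * k * h \<omega> - k\<^sup>2) =
          a\<^sup>2 - 2 * a * v / R\<^sup>2 + 2 * k * expectation h - k\<^sup>2"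
        using int_b int_h by (simp add: Eb prob_space)
      finally have "a\<^sup>2 - 2 * a * v / R\<^sup>2 + 2 * k * expectation h - k\<^sup>2 \<le> expectation (\<lambda>\<omega>. f (s + Y \<omega>))" .
      moreover have "2 * k * k \<le> 2 * k * expectation h"
        using Eh k by (intro mult_left_mono) auto
      ultimately have E2: "a\<^sup>2 - 2 * a * v / R\<^sup>2 + k\<^sup>2 \<le> expectation (\<lambda>\<omega>. f (s + Y \<omega>))"
        by (simp add: power2_eq_square)
      have "2 * a * v / R\<^sup>2 \<le> \<epsilon> * a\<^sup>2 + k\<^sup>2"
      proof -
        \<comment> \<open>For small \<open>a\<close> the fluctuation gain
          \<open>c\<^sup>2 / 4\<close> pays for the drift; otherwise
          \<open>c\<^sup>2 < 8 * a * v\<close>, and \<open>R3\<close> yields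
          \<open>2 * v \<le> \<epsilon> * R\<^sup>2 * a\<close>.\<close>
        have "2 * a * v \<le> \<epsilon> * R\<^sup>2 * a\<^sup>2 + c\<^sup>2 / 4"
        proof (cases "8 * a * v \<le> c\<^sup>2")
          case True
          then show ?thesis
            using \<epsilon> by (simp add: add_increasing)
        next
          case False
          then have "0 < v"
            using v c(1) by (cases "v = 0") auto
          have "2 * v * c\<^sup>2 \<le> 2 * v * (8 * a * v)"
            using False v by (intro mult_left_mono) auto
          also have "\<dots> = 16 * v\<^sup>2 * a"
            by (simp add: power2_eq_square)
          also have "\<dots> \<le> \<epsilon> * c\<^sup>2 * R\<^sup>2 * a"
            using R3 a by (intro mult_right_mono)
          finally have "c\<^sup>2 * (2 * v) \<le> c\<^sup>2 * (\<epsilon> * R\<^sup>2 * a)"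
            by (simp add: mult_ac)
          then have "2 * v \<le> \<epsilon> * R\<^sup>2 * a"
            using c(1) by (subst (asm) mult_le_cancel_left_pos) auto
          then have "a * (2 * v) \<le> a * (\<epsilon> * R\<^sup>2 * a)"
            using a by (intro mult_left_mono)
          then have "2 * a * v \<le> \<epsilon> * R\<^sup>2 * a\<^sup>2"
            by (simp add: power2_eq_square mult_ac)
          then show ?thesis
            by (simp add: add_increasing2)
        qed
        then have "2 * a * v / R\<^sup>2 \<le> (\<epsilon> * R\<^sup>2 * a\<^sup>2 + c\<^sup>2 / 4) / R\<^sup>2"
          by (intro divide_right_mono) auto
        also have "\<dots> = \<epsilon> * a\<^sup>2 + k\<^sup>2"
          using R1 by (simp add: k_def field_simps power2_eq_square)
        finally show ?thesis .
      qed
      then show ?thesis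
        using E2 unfolding fs by (simp add: algebra_simps)
    qed
  qed
  show thesis
  proof (rule that[of R f])
    show "s \<in> V \<and> norm s \<le> R" if "f s \<noteq> 0" for s
      using that outside[of s] DV by (cases "R \<le> norm s") (auto simp: f_def split: if_splits)
    show "f 0 = 1"
      using subD by (simp add: f_def subspace_0)
  qed (use R1 f01 step meas in auto)
qed

subsection \<open>Exponential tilting\<close>

text \<open>Follows from \<open>1 - x \<le> exp (- x)\<close>. The explicit error term allows
  first-order conditions to be derived under the integral sign.\<close>

lemma exp_le_quadratic:
  fixes x :: real
  shows "exp x \<le> 1 + x + x\<^sup>2 * exp \<bar>x\<bar>"
proof -
  have "(1 - x) * exp x \<le> exp (- x) * exp x"
    using exp_ge_add_one_self[of "- x"] by (intro mult_right_mono) auto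
  then have "exp x - 1 - x \<le> x * (exp x - 1)"
    by (simp add: exp_minus algebra_simps)
  moreover have "x * (exp x - 1) \<le> x\<^sup>2 * exp \<bar>x\<bar>"
  proof (cases "0 \<le> x")
    case True
    have "exp x - 1 \<le> x * exp x"
      using \<open>(1 - x) * exp x \<le> exp (- x) * exp x\<close> by (simp add: exp_minus algebra_simps)
    then have "x * (exp x - 1) \<le> x * (x * exp x)"
      using True by (intro mult_left_mono) auto
    then show ?thesis
      using True by (simp add: power2_eq_square)
  next
    case False
    have "1 - exp x \<le> - x"
      using exp_ge_add_one_self[of x] by linarith
    then have "(- x) * (1 - exp x) \<le> (- x) * (- x)"
      using False by (intro mult_left_mono) auto
    then have "x * (exp x - 1) \<le> x\<^sup>2 * 1"
      by (simp add: power2_eq_square algebra_simps)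
    also have "\<dots> \<le> x\<^sup>2 * exp \<bar>x\<bar>"
      by (intro mult_left_mono) auto
    finally show ?thesis .
  qed
  ultimately show ?thesis
    by linarith
qed

lemma square_le_exp_abs: "x\<^sup>2 \<le> 2 * exp \<bar>x\<bar>" for x :: real
  using exp_lower_Taylor_quadratic[of "\<bar>x\<bar>"] by simp

definition tilt :: "(real ^ 'n) set \<Rightarrow> real ^ 'n \<Rightarrow> real ^ 'n \<Rightarrow> real"
  where "tilt V z y = indicator V y * exp (z \<bullet> y)"

text \<open>The Laplace transform of the restriction of \<mu> to \<open>V\<close>, as a real
  number.\<close>

definition tilt_mass :: "(real ^ 'n) measure \<Rightarrow> (real ^ 'n) set \<Rightarrow> real ^ 'n \<Rightarrow> real"
  where "tilt_mass \<mu> V z = (\<integral>y. tilt V z y \<partial>\<mu>)"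

text \<open>Formally the gradient of \<open>tilt_mass\<close> in \<open>z\<close>.\<close>

definition tilt_moment :: "(real ^ 'n) measure \<Rightarrow> (real ^ 'n) set \<Rightarrow> real ^ 'n \<Rightarrow> real ^ 'n"
  where "tilt_moment \<mu> V z = (\<integral>y. tilt V z y *\<^sub>R y \<partial>\<mu>)"

definition tilt_mean :: "(real ^ 'n) measure \<Rightarrow> (real ^ 'n) set \<Rightarrow> real ^ 'n \<Rightarrow> real ^ 'n"
  where "tilt_mean \<mu> V z = (1 / tilt_mass \<mu> V z) *\<^sub>R tilt_moment \<mu> V z"

lemma tilt_nonneg [simp]: "0 \<le> tilt V z y"
  by (simp add: tilt_def)

lemma tilt_le_exp: "tilt V z y \<le> exp (z \<bullet> y)"
  by (simp add: tilt_def indicator_def)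

lemma tilt_add: "tilt V (z + h) y = tilt V z y * exp (h \<bullet> y)"
  by (simp add: tilt_def inner_add_left exp_add)

context step_law
begin

lemma integrable_exp: "integrable \<mu> (\<lambda>y. exp (z \<bullet> y))"
  using laplace_finite[of z] by (intro integrableI_nonneg) (auto simp: laplace_def)

text \<open>The two signs of the coordinate shift \<open>z\<close> by \<open>axis i c\<close> up or
  down, which leads back to ordinary exponential moments.\<close>

lemma integrable_exp_coordinate: "integrable \<mu> (\<lambda>y. exp (c * \<bar>y $ i\<bar>) * exp (z \<bullet> y))"
proof (rule Bochner_Integration.integrable_bound)
  show "integrable \<mu> (\<lambda>y. exp ((z + axis i c) \<bullet> y) + exp ((z - axis i c) \<bullet> y))"
    by (intro Bochner_Integration.integrable_add integrable_exp)
  show "AE y in \<mu>. norm (exp (c * \<bar>y $ i\<bar>) * exp (z \<bullet> y)) \<le>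
      norm (exp ((z + axis i c) \<bullet> y) + exp ((z - axis i c) \<bullet> y))"
  proof (rule AE_I2)
    fix y
    have "exp (c * \<bar>y $ i\<bar>) \<le> exp (c * y $ i) + exp (- (c * y $ i))"
      by (cases "0 \<le> y $ i") auto
    then have "exp (c * \<bar>y $ i\<bar>) * exp (z \<bullet> y) \<le> (exp (c * y $ i) + exp (- (c * y $ i))) * exp (z \<bullet> y)"
      by (rule mult_right_mono) simp
    also have "\<dots> = exp ((z + axis i c) \<bullet> y) + exp ((z - axis i c) \<bullet> y)"
      unfolding distrib_right exp_add[symmetric]
      by (simp add: inner_add_left inner_diff_left inner_axis' add.commute)
    finally show "norm (exp (c * \<bar>y $ i\<bar>) * exp (z \<bullet> y)) \<le>
        norm (exp ((z + axis i c) \<bullet> y) + exp ((z - axis i c) \<bullet> y))"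
      by simp
  qed
qed measurable

text \<open>Quadratic growth is absorbed coordinatewise through \<open>square_le_exp_abs\<close>.
  One criterion thus serves mass, mean and second moment.\<close>

lemma integrable_tilt_bound:
  assumes V [measurable]: "V \<in> sets borel" and [measurable]: "g \<in> borel_measurable borel"
    and bound: "\<And>y. norm (g y) \<le> B * (1 + (norm y)\<^sup>2)"
  shows "integrable \<mu> (\<lambda>y. tilt V z y *\<^sub>R (g y :: 'c :: {banach, second_countable_topology}))"
proof (rule Bochner_Integration.integrable_bound)
  show "integrable \<mu> (\<lambda>y. B * (exp (z \<bullet> y) + (\<Sum>i\<in>UNIV. 2 * (exp (1 * \<bar>y $ i\<bar>) * exp (z \<bullet> y)))))"
    by (intro integrable_mult_right Bochner_Integration.integrable_add integrable_exp
        Bochner_Integration.integrable_sum integrable_exp_coordinate)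
  show "(\<lambda>y. tilt V z y *\<^sub>R g y) \<in> borel_measurable \<mu>"
    unfolding tilt_def by measurable
  have B: "0 \<le> B"
    using order_trans[OF norm_ge_zero bound[of 0]] by simp
  show "AE y in \<mu>. norm (tilt V z y *\<^sub>R g y) \<le>
      norm (B * (exp (z \<bullet> y) + (\<Sum>i\<in>UNIV. 2 * (exp (1 * \<bar>y $ i\<bar>) * exp (z \<bullet> y)))))"
  proof (rule AE_I2)
    fix y :: "real ^ 'n"
    have "(norm y)\<^sup>2 = (\<Sum>i\<in>UNIV. (y $ i)\<^sup>2)"
      unfolding power2_norm_eq_inner inner_vec_def by (simp add: power2_eq_square)
    also have "\<dots> \<le> (\<Sum>i\<in>UNIV. 2 * exp \<bar>y $ i\<bar>)"
      by (intro sum_mono square_le_exp_abs)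
    finally have *: "1 + (norm y)\<^sup>2 \<le> 1 + (\<Sum>i\<in>UNIV. 2 * exp \<bar>y $ i\<bar>)"
      by simp
    have "norm (tilt V z y *\<^sub>R g y) \<le> exp (z \<bullet> y) * (B * (1 + (norm y)\<^sup>2))"
      using bound[of y] B tilt_le_exp[of V z y] by (simp add: mult_mono)
    also have "\<dots> \<le> exp (z \<bullet> y) * (B * (1 + (\<Sum>i\<in>UNIV. 2 * exp \<bar>y $ i\<bar>)))"
      using B * by (intro mult_left_mono) auto
    also have "\<dots> = B * (exp (z \<bullet> y) + (\<Sum>i\<in>UNIV. 2 * (exp (1 * \<bar>y $ i\<bar>) * exp (z \<bullet> y))))"
      by (simp add: algebra_simps sum_distrib_left)
    finally show "norm (tilt V z y *\<^sub>R g y) \<le>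
        norm (B * (exp (z \<bullet> y) + (\<Sum>i\<in>UNIV. 2 * (exp (1 * \<bar>y $ i\<bar>) * exp (z \<bullet> y)))))"
      by simp
  qed
qed

lemma integrable_tilt: "V \<in> sets borel \<Longrightarrow> integrable \<mu> (tilt V z)"
  using integrable_tilt_bound[of V "\<lambda>_. 1 :: real" 1 z] by simp

lemma integrable_tilt_moment: "V \<in> sets borel \<Longrightarrow> integrable \<mu> (\<lambda>y. tilt V z y *\<^sub>R y)"
  by (rule integrable_tilt_bound[where B = 1])
     (simp_all only: measurable_ident_sets norm_le_quadratic mult_1_left)

lemma tilt_moment_inner:
  "V \<in> sets borel \<Longrightarrow> u \<bullet> tilt_moment \<mu> V z = (\<integral>y. tilt V z y * (u \<bullet> y) \<partial>\<mu>)"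
  unfolding tilt_moment_def by (subst integral_inner_right[symmetric]) (auto simp: integrable_tilt_moment)

lemma tilt_moment_mem:
  assumes V: "subspace V"
  shows "tilt_moment \<mu> V z \<in> V"
proof -
  have "V \<in> sets borel"
    by (intro borel_closed closed_subspace V)
  have "tilt_moment \<mu> V z \<in> orthogonal_comp (orthogonal_comp V)"
    unfolding orthogonal_comp_def[of "orthogonal_comp V"]
  proof (intro CollectI ballI)
    fix u assume "u \<in> orthogonal_comp V"
    then have "(\<lambda>y. tilt V z y * (u \<bullet> y)) = (\<lambda>_. 0)"
      by (auto simp: tilt_def orthogonal_comp_def orthogonal_def inner_commute indicator_def)
    then show "orthogonal u (tilt_moment \<mu> V z)"
      using tilt_moment_inner[OF \<open>V \<in> sets borel\<close>, of u z] unfolding orthogonal_def by simp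
  qed
  then show ?thesis
    by (simp add: orthogonal_comp_self[OF V])
qed

lemma tilt_mean_mem: "subspace V \<Longrightarrow> tilt_mean \<mu> V z \<in> V"
  unfolding tilt_mean_def by (intro subspace_scale tilt_moment_mem)

text \<open>This is \<open>almost_eigenfunction\<close> for the centred step under the normalised
  tilted law \<open>M\<close>; undoing the normalisation produces the factor
  \<open>tilt_mass \<mu> V z\<close>.\<close>

lemma tilted_almost_eigenfunction:
  assumes V: "subspace V" and mass: "0 < tilt_mass \<mu> V z" and \<epsilon>: "0 < \<epsilon>"
  obtains R :: real and f :: "real ^ 'n \<Rightarrow> real"
  where "0 < R" "f \<in> borel_measurable borel" "\<And>s. 0 \<le> f s" "\<And>s. f s \<le> 1" "f 0 = 1"
    "\<And>s. f s \<noteq> 0 \<Longrightarrow> s \<in> V \<and> norm s \<le> R"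
    "\<And>s. tilt_mass \<mu> V z * ((1 - \<epsilon>) * f s) \<le> (\<integral>y. tilt V z y * f (s + (y - tilt_mean \<mu> V z)) \<partial>\<mu>)"
proof -
  have Vm [measurable]: "V \<in> sets borel"
    by (intro borel_closed closed_subspace V)
  define L where "L = tilt_mass \<mu> V z"
  have L: "0 < L"
    using mass by (simp add: L_def)
  define m where "m = tilt_mean \<mu> V z"
  define M where "M = density \<mu> (\<lambda>y. ennreal (tilt V z y / L))"
  have [measurable]: "tilt V z \<in> borel_measurable borel"
    unfolding tilt_def by measurable
  have sets_M [measurable_cong]: "sets M = sets borel"
    by (simp add: M_def sets_step)
  have integral_M: "(\<integral>y. g y \<partial>M) = (1 / L) *\<^sub>R (\<integral>y. tilt V z y *\<^sub>R g y \<partial>\<mu>)"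
    if [measurable]: "g \<in> borel_measurable borel" and bd: "\<And>y. norm (g y) \<le> B * (1 + (norm y)\<^sup>2)"
    for g :: "real ^ 'n \<Rightarrow> 'c :: {banach, second_countable_topology}" and B
  proof -
    have "(\<integral>y. g y \<partial>M) = (\<integral>y. (tilt V z y / L) *\<^sub>R g y \<partial>\<mu>)"
      unfolding M_def using L by (intro integral_density) auto
    also have "\<dots> = (\<integral>y. (1 / L) *\<^sub>R (tilt V z y *\<^sub>R g y) \<partial>\<mu>)"
      by (rule Bochner_Integration.integral_cong) simp_all
    also have "\<dots> = (1 / L) *\<^sub>R (\<integral>y. tilt V z y *\<^sub>R g y \<partial>\<mu>)"
      by (intro integral_scaleR_right integrable_tilt_bound[OF Vm that])
    finally show ?thesis .
  qed
  have integrable_M: "integrable M g"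
    if [measurable]: "g \<in> borel_measurable borel" and bd: "\<And>y. norm (g y) \<le> B * (1 + (norm y)\<^sup>2)"
    for g :: "real ^ 'n \<Rightarrow> 'c :: {banach, second_countable_topology}" and B
  proof -
    have "integrable \<mu> (\<lambda>y. (1 / L) *\<^sub>R (tilt V z y *\<^sub>R g y))"
      using integrable_tilt_bound[OF Vm that] by (rule integrable_scaleR_right)
    then have "integrable \<mu> (\<lambda>y. (tilt V z y / L) *\<^sub>R g y)"
      by simp
    then show ?thesis
      unfolding M_def using L by (subst integrable_density) auto
  qed
  interpret M: prob_space M
  proof
    have "emeasure M (space M) = (\<integral>\<^sup>+ y. ennreal (tilt V z y / L) \<partial>\<mu>)"
      by (simp add: M_def emeasure_density)
    also have "\<dots> = ennreal (\<integral>y. tilt V z y / L \<partial>\<mu>)"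
      using L by (intro nn_integral_eq_integral) (auto intro!: integrable_tilt)
    also have "(\<integral>y. tilt V z y / L \<partial>\<mu>) = 1"
      using L by (simp add: L_def tilt_mass_def)
    finally show "emeasure M (space M) = 1"
      by simp
  qed
  have quadratic: "norm y \<le> 1 * (1 + (norm y)\<^sup>2)" for y :: "real ^ 'n"
    by (simp add: norm_le_quadratic)
  have m: "m = (\<integral>y. y \<partial>M)"
    by (subst integral_M[OF _ quadratic]) (simp_all add: m_def tilt_mean_def tilt_moment_def L_def)
  have int_id: "integrable M (\<lambda>y. y)"
    by (rule integrable_M[OF _ quadratic]) simp
  obtain R f where f: "0 < R" "f \<in> borel_measurable borel" "\<And>s. 0 \<le> f s" "\<And>s. f s \<le> 1" "f 0 = 1"
    "\<And>s. f s \<noteq> 0 \<Longrightarrow> s \<in> V \<and> norm s \<le> R"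
    "\<And>s. (1 - \<epsilon>) * f s \<le> M.expectation (\<lambda>y. f (s + (y - m)))"
  proof (rule M.almost_eigenfunction[of "\<lambda>y. y - m" V \<epsilon>])
    show "(\<lambda>y. y - m) \<in> borel_measurable M"
      by measurable
    show "integrable M (\<lambda>y. (norm (y - m))\<^sup>2)"
    proof (rule integrable_M)
      fix y
      have "(norm (y - m))\<^sup>2 \<le> (norm y + norm m)\<^sup>2"
        by (intro power_mono norm_triangle_ineq4) auto
      also have "\<dots> \<le> 2 * (norm y)\<^sup>2 + 2 * (norm m)\<^sup>2"
        using zero_le_power2[of "norm y - norm m"] by (simp add: power2_sum power2_diff)
      also have "\<dots> \<le> (2 + 2 * (norm m)\<^sup>2) * (1 + (norm y)\<^sup>2)"
        by (simp add: algebra_simps)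
      finally show "norm ((norm (y - m))\<^sup>2) \<le> (2 + 2 * (norm m)\<^sup>2) * (1 + (norm y)\<^sup>2)"
        by simp
    qed measurable
    show "M.expectation (\<lambda>y. y - m) = 0"
      using int_id by (simp add: m M.prob_space)
    show "AE y in M. y - m \<in> V"
      unfolding M_def
    proof (subst AE_density)
      show "AE y in \<mu>. 0 < ennreal (tilt V z y / L) \<longrightarrow> y - m \<in> V"
        using V tilt_mean_mem[OF V, of z]
        by (auto simp: tilt_def indicator_def m_def intro!: subspace_diff)
    qed measurable
  qed (use V \<epsilon> in auto)
  show thesis
  proof (rule that[of R f])
    fix s
    have "L * ((1 - \<epsilon>) * f s) \<le> L * M.expectation (\<lambda>y. f (s + (y - m)))"
      using f(7) L by (intro mult_left_mono) auto
    also have "\<dots> = (\<integral>y. tilt V z y * f (s + (y - m)) \<partial>\<mu>)"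
    proof -
      have bd: "norm (f (s + (y - m))) \<le> 1 * (1 + (norm y)\<^sup>2)" for y
        using f(3,4) by (simp add: add_increasing2)
      show ?thesis
        using f(2) L by (subst integral_M[OF _ bd]) simp_all
    qed
    finally show "tilt_mass \<mu> V z * ((1 - \<epsilon>) * f s) \<le>
        (\<integral>y. tilt V z y * f (s + (y - tilt_mean \<mu> V z)) \<partial>\<mu>)"
      by (simp add: L_def m_def)
  qed (use f in auto)
qed

text \<open>Change of measure in a tube about the line through \<open>x\<close> with direction the
  tilted mean: the tilt is telescoped along the path, and each unit of drift costs
  \<open>exp (- (z \<bullet> tilt_mean \<mu> V z))\<close>. The bound \<gamma> for the terminal ball
  lets two tubes be concatenated, so \<open>R\<close> and \<open>c\<close> must not depend on
  \<open>x\<close>, \<open>N\<close>, \<open>n\<close> or \<gamma>.\<close>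

lemma survival_tube:
  assumes V: "subspace V" and mass: "0 < tilt_mass \<mu> V z" and \<epsilon>: "0 < \<epsilon>" "\<epsilon> \<le> 1"
  shows "\<exists>R>0. \<exists>c>0. \<forall>x N n \<gamma>.
    (\<forall>s\<in>V. norm s \<le> R \<longrightarrow> \<gamma> \<le> survival \<mu> n (x + real N *\<^sub>R tilt_mean \<mu> V z + s)) \<longrightarrow>
    (\<forall>k\<in>{1..N}. \<forall>s\<in>V. norm s \<le> R \<longrightarrow> x + real k *\<^sub>R tilt_mean \<mu> V z + s \<in> orthant) \<longrightarrow>
    ennreal (c * (tilt_mass \<mu> V z * (1 - \<epsilon>) * exp (- (z \<bullet> tilt_mean \<mu> V z))) ^ N) * \<gamma>
      \<le> survival \<mu> (N + n) x"
proof -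
  define L where "L = tilt_mass \<mu> V z"
  define m where "m = tilt_mean \<mu> V z"
  have L: "0 < L"
    using mass by (simp add: L_def)
  have [measurable]: "V \<in> sets borel"
    by (intro borel_closed closed_subspace V)
  obtain R f where R: "0 < R" and [measurable]: "f \<in> borel_measurable borel"
    and f: "\<And>s. 0 \<le> f s" "\<And>s. f s \<le> 1" "f 0 = 1" "\<And>s. f s \<noteq> 0 \<Longrightarrow> s \<in> V \<and> norm s \<le> R"
    and step: "\<And>s. L * ((1 - \<epsilon>) * f s) \<le> (\<integral>y. tilt V z y * f (s + (y - m)) \<partial>\<mu>)"
    by (rule tilted_almost_eigenfunction[OF V mass \<epsilon>(1)]) (fold L_def m_def, rule that)
  have [measurable]: "tilt V z \<in> borel_measurable borel"
    unfolding tilt_def by measurable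
  define A where "A = L * (1 - \<epsilon>) * exp (- (z \<bullet> m))"
  have A: "0 \<le> A"
    using L \<epsilon> by (simp add: A_def)
  \<comment> \<open>Chosen so that \<open>C * exp (z \<bullet> s) \<le> 1\<close> on the ball of
    radius \<open>R\<close>: the cost of removing the tilt at the end.\<close>
  define C where "C = exp (- (norm z * R))"
  have C: "0 < C"
    by (simp add: C_def)
  \<comment> \<open>The induction needs an arbitrary displacement \<open>s\<close> from the centre
    of the tube, weighted by \<open>f s\<close>; only \<open>s = 0\<close> is used in the
    end.\<close>
  have *: "ennreal (C * exp (z \<bullet> s) * f s * A ^ N) * \<gamma> \<le> survival \<mu> (N + n) (x + s)"
    if "\<And>s. s \<in> V \<Longrightarrow> norm s \<le> R \<Longrightarrow> \<gamma> \<le> survival \<mu> n (x + real N *\<^sub>R m + s)"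
      "\<And>k s. 1 \<le> k \<Longrightarrow> k \<le> N \<Longrightarrow> s \<in> V \<Longrightarrow> norm s \<le> R \<Longrightarrow> x + real k *\<^sub>R m + s \<in> orthant"
    for N n x s \<gamma>
    using that
  proof (induction N arbitrary: x s)
    case 0
    show ?case
    proof (cases "f s = 0")
      case False
      then have s: "s \<in> V" "norm s \<le> R"
        using f(4) by auto
      have "z \<bullet> s \<le> norm z * R"
        using norm_cauchy_schwarz[of z s] s(2) by (meson mult_left_mono norm_ge_zero order_trans)
      then have "C * exp (z \<bullet> s) \<le> 1"
        unfolding C_def exp_add[symmetric] by simp
      from mult_mono[OF this f(2)[of s] _ f(1)[of s]] have "C * exp (z \<bullet> s) * f s \<le> 1"
        by simp
      then have "ennreal (C * exp (z \<bullet> s) * f s * A ^ 0) * \<gamma> \<le> 1 * \<gamma>"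
        by (intro mult_right_mono) (auto simp: ennreal_le_1)
      also have "\<dots> \<le> survival \<mu> n (x + s)"
        using 0(1)[OF s] by simp
      finally show ?thesis
        by simp
    qed simp
  next
    case (Suc N)
    \<comment> \<open>Displacement from the new centre \<open>x + m\<close> after the step
      \<open>y\<close>.\<close>
    define t where "t y = s + (y - m)" for y
    have shift: "x + s + y = (x + m) + t y" for y
      by (simp add: t_def)
    have IH: "ennreal (C * exp (z \<bullet> t y) * f (t y) * A ^ N) * \<gamma> \<le> survival \<mu> (N + n) (x + s + y)" for y
      unfolding shift
    proof (rule Suc.IH)
      show "\<gamma> \<le> survival \<mu> n (x + m + real N *\<^sub>R m + s)" if "s \<in> V" "norm s \<le> R" for s
        using Suc.prems(1)[OF that] by (simp add: algebra_simps)
      show "x + m + real k *\<^sub>R m + s \<in> orthant" if "1 \<le> k" "k \<le> N" "s \<in> V" "norm s \<le> R" for k s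
        using Suc.prems(2)[of "Suc k" s] that by (simp add: algebra_simps)
    qed
    define K where "K = C * exp (z \<bullet> s) * exp (- (z \<bullet> m)) * A ^ N"
    have K: "0 \<le> K"
      using C A by (simp add: K_def)
    have int: "integrable \<mu> (\<lambda>y. tilt V z y * f (t y))"
      unfolding t_def
      using integrable_tilt_bound[of V "\<lambda>y. f (s + (y - m))" 1 z] f by (simp add: add_increasing2)
    have "C * exp (z \<bullet> s) * f s * A ^ Suc N = K * (L * ((1 - \<epsilon>) * f s))"
      by (simp add: K_def A_def mult_ac)
    also have "\<dots> \<le> K * (\<integral>y. tilt V z y * f (t y) \<partial>\<mu>)"
      using step[of s] K by (intro mult_left_mono) (auto simp: t_def)
    also have "\<dots> = (\<integral>y. K * (tilt V z y * f (t y)) \<partial>\<mu>)"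
      by simp
    finally have "ennreal (C * exp (z \<bullet> s) * f s * A ^ Suc N) * \<gamma> \<le>
        ennreal (\<integral>y. K * (tilt V z y * f (t y)) \<partial>\<mu>) * \<gamma>"
      by (intro mult_right_mono ennreal_leI) auto
    also have "\<dots> = (\<integral>\<^sup>+ y. ennreal (K * (tilt V z y * f (t y))) \<partial>\<mu>) * \<gamma>"
      using int K f(1) by (subst nn_integral_eq_integral) auto
    also have "\<dots> = (\<integral>\<^sup>+ y. ennreal (K * (tilt V z y * f (t y))) * \<gamma> \<partial>\<mu>)"
      unfolding t_def by (rule nn_integral_multc[symmetric]) measurable
    also have "\<dots> \<le> (\<integral>\<^sup>+ y. indicator orthant (x + s + y) * survival \<mu> (N + n) (x + s + y) \<partial>\<mu>)"
    proof (rule nn_integral_mono)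
      fix y
      show "ennreal (K * (tilt V z y * f (t y))) * \<gamma> \<le>
          indicator orthant (x + s + y) * survival \<mu> (N + n) (x + s + y)"
      proof (cases "y \<in> V \<and> f (t y) \<noteq> 0")
        case True
        then have "x + s + y \<in> orthant"
          using Suc.prems(2)[of 1 "t y"] f(4)[of "t y"] unfolding shift by simp
        moreover have "K * (tilt V z y * f (t y)) = C * exp (z \<bullet> t y) * f (t y) * A ^ N"
          using True
          by (simp add: K_def tilt_def t_def inner_add_right inner_diff_right exp_add exp_diff
              exp_minus field_simps)
        ultimately show ?thesis
          using IH[of y] by (simp only: indicator_simps mult_1_left)
      qed (auto simp: tilt_def)
    qed
    finally show ?case
      by simp
  qed
  show ?thesis
  proof (rule exI[of _ R], intro conjI R, rule exI[of _ C], intro conjI C allI impI)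
    fix x N n \<gamma>
    assume "\<forall>s\<in>V. norm s \<le> R \<longrightarrow> \<gamma> \<le> survival \<mu> n (x + real N *\<^sub>R tilt_mean \<mu> V z + s)"
      "\<forall>k\<in>{1..N}. \<forall>s\<in>V. norm s \<le> R \<longrightarrow> x + real k *\<^sub>R tilt_mean \<mu> V z + s \<in> orthant"
    then have "ennreal (C * exp (z \<bullet> 0) * f 0 * A ^ N) * \<gamma> \<le> survival \<mu> (N + n) (x + 0)"
      by (intro *) (auto simp: m_def)
    then show "ennreal (C * (tilt_mass \<mu> V z * (1 - \<epsilon>) * exp (- (z \<bullet> tilt_mean \<mu> V z))) ^ N) * \<gamma>
        \<le> survival \<mu> (N + n) x"
      by (simp add: f(3) A_def L_def m_def)
  qed
qed

end

subsection \<open>Reduced support\<close>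

text \<open>The flats of \<open>admissible\<close>. For \<open>k = 0\<close> this is the whole
  space, which makes the condition on the first vector an instance of the others.\<close>

definition tuple_flat :: "(real ^ 'n) list \<Rightarrow> nat \<Rightarrow> (real ^ 'n) set"
  where "tuple_flat us k = (\<Inter>j<k. hyperplane (us ! j))"

lemma tuple_flat_borel [measurable]: "tuple_flat us k \<in> sets borel"
  unfolding tuple_flat_def by (intro sets.countable_INT'') auto

lemma tuple_flat_length: "tuple_flat us (length us) = orthogonal_comp (span (set us))"
proof
  show "tuple_flat us (length us) \<subseteq> orthogonal_comp (span (set us))"
  proof
    fix x assume x: "x \<in> tuple_flat us (length us)"
    have "orthogonal x v" if "v \<in> span (set us)" for v
      by (rule orthogonal_to_span[OF that])
         (use x in \<open>auto simp: tuple_flat_def hyperplane_def orthogonal_def in_set_conv_nth\<close>)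
    then show "x \<in> orthogonal_comp (span (set us))"
      by (auto simp: orthogonal_comp_def orthogonal_commute)
  qed
  show "orthogonal_comp (span (set us)) \<subseteq> tuple_flat us (length us)"
    using span_base[of _ "set us"]
    by (fastforce simp: orthogonal_comp_def orthogonal_def tuple_flat_def hyperplane_def inner_commute)
qed

lemma admissible_snoc:
  assumes us: "us = [] \<or> admissible \<mu> us" and u: "u \<in> orthant" "u \<notin> span (set us)"
    and meas: "measure \<mu> (neg_halfspace u \<inter> tuple_flat us (length us)) = measure \<mu> (tuple_flat us (length us))"
    and total: "measure \<mu> UNIV = 1"
  shows "admissible \<mu> (us @ [u])"
proof (cases "us = []")
  case True
  then show ?thesis
    using u meas total by (auto simp: admissible_def tuple_flat_def)
next
  case False
  with us have adm: "admissible \<mu> us"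
    by simp
  have "independent (insert u (set us))"
    using adm u(2) by (simp add: admissible_def independent_insertI)
  moreover have "u \<notin> set us"
    using u(2) span_base by blast
  moreover have "measure \<mu> (neg_halfspace ((us @ [u]) ! i) \<inter> tuple_flat (us @ [u]) i) =
      measure \<mu> (tuple_flat (us @ [u]) i)" if i: "1 \<le> i" "i < length (us @ [u])" for i
  proof -
    have eq: "tuple_flat (us @ [u]) i = tuple_flat us i"
      using i by (auto simp: tuple_flat_def nth_append)
    show ?thesis
    proof (cases "i = length us")
      case True
      then show ?thesis
        using meas unfolding eq by simp
    next
      case False
      then show ?thesis
        using i adm unfolding eq by (simp add: nth_append admissible_def tuple_flat_def)
    qed
  qed
  ultimately show ?thesis
    using adm u(1) by (simp add: admissible_def nth_append tuple_flat_def)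
qed

lemma orthant_add: "x \<in> orthant \<Longrightarrow> y \<in> orthant \<Longrightarrow> x + y \<in> orthant"
  by (simp add: orthant_def)

lemma orthant_scaleR: "x \<in> orthant \<Longrightarrow> 0 \<le> c \<Longrightarrow> c *\<^sub>R x \<in> orthant"
  by (simp add: orthant_def)

subsection \<open>Minimisation of the restricted Laplace transform\<close>

lemma orthant_eq_convex_cone_hull:
  "(orthant :: (real ^ 'n) set) = convex_cone hull range (\<lambda>i. axis i 1)"
proof
  have "x \<in> convex_cone hull range (\<lambda>i. axis i 1)" if "x \<in> orthant" for x :: "real ^ 'n"
  proof -
    have "(\<Sum>i\<in>A. x $ i *\<^sub>R axis i 1) \<in> convex_cone hull range (\<lambda>i. axis i 1)" for A :: "'n set"
    proof (induction A rule: infinite_finite_induct)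
      case (insert i A)
      then show ?case
        using that by (simp add: convex_cone_hull_add convex_cone_hull_mul hull_inc orthant_def)
    qed (simp_all add: convex_cone_hull_contains_0)
    moreover have "(\<Sum>i\<in>UNIV. x $ i *\<^sub>R axis i 1) = x"
      using basis_expansion[of x] by (simp add: scalar_mult_eq_scaleR)
    ultimately show ?thesis
      by metis
  qed
  then show "(orthant :: (real ^ 'n) set) \<subseteq> convex_cone hull range (\<lambda>i. axis i 1)"
    by blast
  have "convex_cone (orthant :: (real ^ 'n) set)"
    unfolding convex_cone_iff by (auto simp: orthant_def)
  moreover have "range (\<lambda>i. axis i 1) \<subseteq> (orthant :: (real ^ 'n) set)"
    by (auto simp: orthant_def axis_def)
  ultimately show "convex_cone hull range (\<lambda>i. axis i 1) \<subseteq> (orthant :: (real ^ 'n) set)"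
    by (simp add: hull_minimal)
qed

text \<open>Closedness survives because the image is a convex cone generated by finitely many
  vectors.\<close>

lemma closed_linear_image_orthant:
  assumes "linear (p :: real ^ 'n \<Rightarrow> 'b :: euclidean_space)"
  shows "closed (p ` orthant)"
  unfolding orthant_eq_convex_cone_hull convex_cone_hull_linear_image[OF assms, symmetric]
  by (intro closed_convex_cone_hull) simp

lemma orthogonal_projection_exists:
  fixes V :: "'a :: euclidean_space set"
  assumes "subspace V"
  obtains p where "linear p" "\<And>x. p x \<in> V" "\<And>x v. v \<in> V \<Longrightarrow> p x \<bullet> v = x \<bullet> v"
proof -
  obtain B where B: "B \<subseteq> V" "pairwise orthogonal B" "span B = V"
    using orthogonal_basis_subspace[OF assms] by metis
  define p where "p x = (\<Sum>b\<in>B. (b \<bullet> x / (b \<bullet> b)) *\<^sub>R b)" for x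
  have "linear p"
    unfolding p_def
    by (rule linearI) (simp_all add: inner_add_right add_divide_distrib scaleR_add_left sum.distrib
        scaleR_sum_right)
  moreover have "p x \<in> V" for x
    unfolding p_def using B(1) assms by (auto intro!: subspace_sum subspace_scale)
  moreover have "p x \<bullet> v = x \<bullet> v" if "v \<in> V" for x v
    using Gram_Schmidt_step[OF B(2), of v x] that B(3)
    by (simp add: orthogonal_def p_def inner_diff_right inner_commute)
  ultimately show thesis
    by (rule that)
qed

lemma nonneg_of_quadratic_bound:
  fixes b C d :: real
  assumes d: "0 < d" and C: "0 \<le> C" and le: "\<And>t. 0 < t \<Longrightarrow> t \<le> d \<Longrightarrow> 0 \<le> t * b + t\<^sup>2 * C"
  shows "0 \<le> b"
proof (rule ccontr)
  assume "\<not> 0 \<le> b"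
  \<comment> \<open>Small enough that \<open>b + t * C \<le> - t\<close>; the added 1 provides
    strictness and a nonzero denominator.\<close>
  define t where "t = min d (- b / (C + 1))"
  have t: "0 < t" "t \<le> d" "t \<le> - b / (C + 1)"
    using d C \<open>\<not> 0 \<le> b\<close> by (auto simp: t_def divide_neg_pos)
  then have "t * (C + 1) \<le> - b"
    using C pos_le_divide_eq[of "C + 1" t "- b"] by simp
  then have "b + t * C < 0"
    using t(1) by (simp add: algebra_simps)
  then have "t * (b + t * C) < 0"
    using t(1) by (simp add: mult_pos_neg)
  then show False
    using le[OF t(1,2)] by (simp add: power2_eq_square algebra_simps)
qed

context step_law
begin

section \<open>The reduced support in almost-sure form, and limits along its tuple\<close>

lemma AE_of_measure_Int_eq:
  assumes [measurable]: "H \<in> sets borel" "A \<in> sets borel" and eq: "measure \<mu> (H \<inter> A) = measure \<mu> A"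
  shows "AE y in \<mu>. y \<in> A \<longrightarrow> y \<in> H"
proof (rule AE_I')
  have "measure \<mu> (A - H) = 0"
    using finite_measure_Diff'[of A H] eq by (simp add: Int_commute sets_step)
  then show "A - H \<in> null_sets \<mu>"
    by (simp add: null_sets_def emeasure_eq_measure sets_step)
qed auto

lemma measure_Int_eq_of_AE:
  assumes [measurable]: "H \<in> sets borel" "A \<in> sets borel" and ae: "AE y in \<mu>. y \<in> A \<longrightarrow> y \<in> H"
  shows "measure \<mu> (H \<inter> A) = measure \<mu> A"
  by (rule finite_measure_eq_AE) (use ae in auto)

text \<open>Take a maximal admissible tuple, or the empty list if none is admissible. A vector of
  the orthant outside its span that were almost surely nonpositive on the reduced support would
  extend the tuple.\<close>

lemma reduced_support_characterization:
  obtains us where "set us \<subseteq> orthant" "reduced_support \<mu> = tuple_flat us (length us)"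
    "\<And>k. k < length us \<Longrightarrow> AE y in \<mu>. y \<in> tuple_flat us k \<longrightarrow> us ! k \<bullet> y \<le> 0"
    "\<And>u. u \<in> orthant \<Longrightarrow> u \<notin> orthogonal_comp (reduced_support \<mu>) \<Longrightarrow>
      \<not> (AE y in \<mu>. y \<in> reduced_support \<mu> \<longrightarrow> u \<bullet> y \<le> 0)"
proof -
  obtain us where us: "us = [] \<or> admissible \<mu> us" and V: "reduced_support \<mu> = tuple_flat us (length us)"
    and max: "\<And>u. u \<in> orthant \<Longrightarrow> \<not> admissible \<mu> (us @ [u])"
  proof (cases "\<exists>us. admissible \<mu> us")
    case True
    then obtain us where "maximal_admissible \<mu> us"
      using exists_maximal_admissible by blast
    then show ?thesis
      using that[of us] reduced_support_eq[OF prob_space_axioms sets_step]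
      by (auto simp: tuple_flat_length maximal_admissible_def)
  next
    case False
    then show ?thesis
      using that[of "[]"] by (simp add: reduced_support_def tuple_flat_def)
  qed
  have total: "measure \<mu> UNIV = 1"
    using prob_space by simp
  show thesis
  proof (rule that[of us])
    show "set us \<subseteq> orthant"
      using us by (auto simp: admissible_def)
    show "AE y in \<mu>. y \<in> tuple_flat us k \<longrightarrow> us ! k \<bullet> y \<le> 0" if k: "k < length us" for k
    proof -
      have adm: "admissible \<mu> us"
        using us k by auto
      have "measure \<mu> (neg_halfspace (us ! k) \<inter> tuple_flat us k) = measure \<mu> (tuple_flat us k)"
      proof (cases "k = 0")
        case True
        then show ?thesis
          using adm total by (simp add: admissible_def tuple_flat_def)
      next
        case False
        then show ?thesis
          using adm k by (simp add: admissible_def tuple_flat_def)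
      qed
      from AE_of_measure_Int_eq[OF _ _ this] show ?thesis
        by (simp add: neg_halfspace_def inner_commute)
    qed
    show "\<not> (AE y in \<mu>. y \<in> reduced_support \<mu> \<longrightarrow> u \<bullet> y \<le> 0)"
      if u: "u \<in> orthant" "u \<notin> orthogonal_comp (reduced_support \<mu>)" for u
    proof
      assume "AE y in \<mu>. y \<in> reduced_support \<mu> \<longrightarrow> u \<bullet> y \<le> 0"
      then have "AE y in \<mu>. y \<in> tuple_flat us (length us) \<longrightarrow> y \<in> neg_halfspace u"
        by (simp add: V neg_halfspace_def inner_commute)
      then have "measure \<mu> (neg_halfspace u \<inter> tuple_flat us (length us)) = measure \<mu> (tuple_flat us (length us))"
        by (intro measure_Int_eq_of_AE) auto
      moreover have "u \<notin> span (set us)"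
        using u(2) by (auto simp: V tuple_flat_length orthogonal_comp_self)
      ultimately show False
        using admissible_snoc[OF us u(1) _ _ total] max u(1) by blast
    qed
  qed (rule V)
qed

text \<open>On the flat of level \<open>k\<close>, \<open>exp (us ! k \<bullet> y) ^ i\<close>
  decreases almost surely to the indicator of the next hyperplane; monotone convergence from above
  applies since the Laplace transform is finite.\<close>

lemma nn_integral_tuple_flat_Suc:
  assumes ae: "AE y in \<mu>. y \<in> tuple_flat us k \<longrightarrow> us ! k \<bullet> y \<le> 0"
  shows "(\<integral>\<^sup>+ y. ennreal (tilt (tuple_flat us (Suc k)) z y) \<partial>\<mu>) =
    (INF i. \<integral>\<^sup>+ y. ennreal (tilt (tuple_flat us k) (z + real i *\<^sub>R us ! k) y) \<partial>\<mu>)"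
proof -
  define g where "g i y = ennreal (tilt (tuple_flat us k) (z + real i *\<^sub>R us ! k) y)" for i y
  have [measurable]: "g i \<in> borel_measurable \<mu>" for i
    unfolding g_def tilt_def by measurable
  have g: "g i y = ennreal (tilt (tuple_flat us k) z y * exp (us ! k \<bullet> y) ^ i)" for i y
    by (simp add: g_def tilt_add exp_of_nat_mult)
  have dec: "AE y in \<mu>. g (Suc i) y \<le> g i y" for i
    using ae
  proof eventually_elim
    case (elim y)
    show ?case
    proof (cases "y \<in> tuple_flat us k")
      case True
      then have "exp (us ! k \<bullet> y) ^ Suc i \<le> exp (us ! k \<bullet> y) ^ i"
        using elim by (intro power_decreasing) auto
      then show ?thesis
        unfolding g by (intro ennreal_leI mult_left_mono) auto
    qed (simp add: g tilt_def)
  qed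
  have "AE y in \<mu>. ennreal (tilt (tuple_flat us (Suc k)) z y) = (INF i. g i y)"
    using ae
  proof eventually_elim
    case (elim y)
    show ?case
    proof (cases "y \<in> tuple_flat us k")
      case True
      have "decseq (\<lambda>i. g i y)"
      proof (rule decseq_SucI)
        fix i
        have "exp (us ! k \<bullet> y) ^ Suc i \<le> exp (us ! k \<bullet> y) ^ i"
          using elim True by (intro power_decreasing) auto
        then show "g (Suc i) y \<le> g i y"
          unfolding g by (intro ennreal_leI mult_left_mono) auto
      qed
      then have "(\<lambda>i. g i y) \<longlonglongrightarrow> (INF i. g i y)"
        by (rule LIMSEQ_INF)
      moreover have "(\<lambda>i. g i y) \<longlonglongrightarrow> ennreal (tilt (tuple_flat us (Suc k)) z y)"
      proof (cases "us ! k \<bullet> y = 0")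
        case eq: True
        then have "tilt (tuple_flat us (Suc k)) z y = tilt (tuple_flat us k) z y"
          by (auto simp: tilt_def tuple_flat_def lessThan_Suc hyperplane_def indicator_def inner_commute)
        then show ?thesis
          using eq by (simp add: g)
      next
        case False
        then have "us ! k \<bullet> y < 0"
          using elim True by simp
        then have "(\<lambda>i. tilt (tuple_flat us k) z y * exp (us ! k \<bullet> y) ^ i) \<longlonglongrightarrow> tilt (tuple_flat us k) z y * 0"
          by (intro tendsto_mult tendsto_const LIMSEQ_power_zero) simp
        moreover have "tilt (tuple_flat us (Suc k)) z y = 0"
          using False by (simp add: tilt_def tuple_flat_def lessThan_Suc hyperplane_def inner_commute)
        ultimately show ?thesis
          unfolding g by (intro tendsto_ennrealI) simp
      qed
      ultimately show ?thesis
        using LIMSEQ_unique by blast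
    next
      case False
      then show ?thesis
        by (simp add: g tilt_def tuple_flat_def lessThan_Suc)
    qed
  qed
  then have "(\<integral>\<^sup>+ y. ennreal (tilt (tuple_flat us (Suc k)) z y) \<partial>\<mu>) = (\<integral>\<^sup>+ y. (INF i. g i y) \<partial>\<mu>)"
    by (rule nn_integral_cong_AE)
  also have "\<dots> = (INF i. integral\<^sup>N \<mu> (g i))"
  proof (rule nn_integral_monotone_convergence_INF_AE[where i = 0])
    show "AE y in \<mu>. g (Suc i) y \<le> g i y" for i
      by (rule dec)
    have "integral\<^sup>N \<mu> (g 0) \<le> laplace \<mu> z"
      unfolding laplace_def g_def using tilt_le_exp[of "tuple_flat us k" z]
      by (intro nn_integral_mono) (simp add: ennreal_leI)
    then show "integral\<^sup>N \<mu> (g 0) < \<infinity>"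
      using laplace_finite[of z] by (rule order.strict_trans1)
  qed measurable
  finally show ?thesis
    by (simp add: g_def[abs_def])
qed

text \<open>Induction on the level of the flat: the shifted points
  \<open>z + real i *\<^sub>R us ! k\<close> remain in the orthant, so the bound passes to the
  infimum over \<open>i\<close>.\<close>

lemma INF_laplace_le_tilt_mass:
  assumes us: "set us \<subseteq> orthant"
    and ae: "\<And>k. k < length us \<Longrightarrow> AE y in \<mu>. y \<in> tuple_flat us k \<longrightarrow> us ! k \<bullet> y \<le> 0"
    and z: "z \<in> orthant"
  shows "(INF z\<in>orthant. laplace \<mu> z) \<le> ennreal (tilt_mass \<mu> (tuple_flat us (length us)) z)"
proof -
  have "(INF z\<in>orthant. laplace \<mu> z) \<le> (\<integral>\<^sup>+ y. ennreal (tilt (tuple_flat us k) z y) \<partial>\<mu>)"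
    if "k \<le> length us" "z \<in> orthant" for k z
    using that
  proof (induction k arbitrary: z)
    case 0
    have "(\<integral>\<^sup>+ y. ennreal (tilt (tuple_flat us 0) z y) \<partial>\<mu>) = laplace \<mu> z"
      by (simp add: laplace_def tilt_def tuple_flat_def)
    then show ?case
      using 0 by (simp add: INF_lower)
  next
    case (Suc k)
    have "us ! k \<in> orthant"
      using us Suc.prems by auto
    then have "(INF z\<in>orthant. laplace \<mu> z) \<le>
        (\<integral>\<^sup>+ y. ennreal (tilt (tuple_flat us k) (z + real i *\<^sub>R us ! k) y) \<partial>\<mu>)" for i
      using Suc.prems by (intro Suc.IH orthant_add orthant_scaleR) auto
    then show ?case
      using Suc.prems by (subst nn_integral_tuple_flat_Suc[OF ae]) (auto intro: INF_greatest)
  qed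
  from this[OF order_refl z] show ?thesis
    unfolding tilt_mass_def by (simp add: nn_integral_eq_integral integrable_tilt)
qed

section \<open>Existence of the minimiser and first-order conditions\<close>

lemma convex_tilt_mass:
  assumes V: "V \<in> sets borel"
  shows "convex_on UNIV (tilt_mass \<mu> V)"
proof (rule convex_onI)
  fix t :: real and x y :: "real ^ 'n"
  assume t: "0 < t" "t < 1"
  have "tilt_mass \<mu> V ((1 - t) *\<^sub>R x + t *\<^sub>R y) \<le>
      (\<integral>v. (1 - t) * tilt V x v + t * tilt V y v \<partial>\<mu>)"
    unfolding tilt_mass_def
  proof (rule integral_mono)
    fix v
    have "exp ((1 - t) * (x \<bullet> v) + t * (y \<bullet> v)) \<le> (1 - t) * exp (x \<bullet> v) + t * exp (y \<bullet> v)"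
      using convex_onD[OF exp_convex, of t "x \<bullet> v" "y \<bullet> v"] t by simp
    then show "tilt V ((1 - t) *\<^sub>R x + t *\<^sub>R y) v \<le> (1 - t) * tilt V x v + t * tilt V y v"
      by (simp add: tilt_def inner_add_left indicator_def)
  qed (intro Bochner_Integration.integrable_add integrable_mult_right integrable_tilt V)+
  also have "\<dots> = (1 - t) * tilt_mass \<mu> V x + t * tilt_mass \<mu> V y"
    unfolding tilt_mass_def using integrable_tilt[OF V] by simp
  finally show "tilt_mass \<mu> V ((1 - t) *\<^sub>R x + t *\<^sub>R y) \<le>
      (1 - t) * tilt_mass \<mu> V x + t * tilt_mass \<mu> V y" .
qed simp

text \<open>The objective depends only on the projection of \<open>z\<close> to \<open>V\<close>. On
  the projected orthant \<open>tilt_mass\<close> dominates an expected positive part, hence grows at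
  least like \<open>c * norm u\<close>, and a linear term with \<open>norm a < c\<close> cannot
  destroy coercivity.\<close>

lemma tilt_mass_attains_min:
  assumes V: "subspace V"
    and max: "\<And>u. u \<in> orthant \<Longrightarrow> u \<notin> orthogonal_comp V \<Longrightarrow> \<not> (AE y in \<mu>. y \<in> V \<longrightarrow> u \<bullet> y \<le> 0)"
  obtains c where "0 < c"
    "\<And>a. a \<in> V \<Longrightarrow> norm a < c \<Longrightarrow>
      \<exists>z\<in>orthant. \<forall>w\<in>orthant. tilt_mass \<mu> V z - a \<bullet> z \<le> tilt_mass \<mu> V w - a \<bullet> w"
proof -
  have Vm [measurable]: "V \<in> sets borel"
    by (intro borel_closed closed_subspace V)
  obtain p where p: "linear p" "\<And>x. p x \<in> V" "\<And>x v. v \<in> V \<Longrightarrow> p x \<bullet> v = x \<bullet> v"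
    using orthogonal_projection_exists[OF V] by metis
  define K where "K = p ` orthant"
  have clK: "closed K"
    unfolding K_def by (rule closed_linear_image_orthant[OF p(1)])
  define Y where "Y y = tilt V 0 y *\<^sub>R y" for y
  have intY: "integrable \<mu> Y"
    unfolding Y_def by (rule integrable_tilt_moment[OF Vm])
  obtain c where c: "0 < c" "\<And>u. u \<in> K \<Longrightarrow> c * norm u \<le> (\<integral>y. max 0 (u \<bullet> Y y) \<partial>\<mu>)"
  proof (rule positive_part_lower_bound[OF intY clK])
    show "c *\<^sub>R u \<in> K" if u: "u \<in> K" and "0 \<le> c" for u c
    proof -
      obtain z where "z \<in> orthant" "u = p z"
        using u by (auto simp: K_def)
      then show ?thesis
        using \<open>0 \<le> c\<close> p(1) by (auto simp: K_def linear_scale orthant_scaleR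
            intro!: image_eqI[of _ _ "c *\<^sub>R z"])
    qed
    show "\<not> (AE y in \<mu>. u \<bullet> Y y \<le> 0)" if u: "u \<in> K" "u \<noteq> 0" for u
    proof
      assume ae: "AE y in \<mu>. u \<bullet> Y y \<le> 0"
      obtain z where z: "z \<in> orthant" "u = p z"
        using u by (auto simp: K_def)
      \<comment> \<open>This inner product equals \<open>p z \<bullet> p z\<close>, so a nonzero
        projection certifies that \<open>z\<close> is not orthogonal to \<open>V\<close>.\<close>
      have "p z \<bullet> z \<noteq> 0"
        using u(2) p(2)[of z] p(3)[of "p z" z] z(2) by (auto simp: inner_commute)
      then have "z \<notin> orthogonal_comp V"
        using p(2)[of z] by (auto simp: orthogonal_comp_def orthogonal_def)
      moreover have "AE y in \<mu>. y \<in> V \<longrightarrow> z \<bullet> y \<le> 0"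
        using ae
      proof eventually_elim
        case (elim y)
        then show ?case
          using p(3)[of y z] by (auto simp: Y_def tilt_def z(2))
      qed
      ultimately show False
        using max[OF z(1)] by blast
    qed
  qed (rule that)
  have min: "\<exists>z\<in>orthant. \<forall>w\<in>orthant. tilt_mass \<mu> V z - a \<bullet> z \<le> tilt_mass \<mu> V w - a \<bullet> w"
    if a: "a \<in> V" "norm a < c" for a
  proof -
    define F where "F u = tilt_mass \<mu> V u - a \<bullet> u" for u
    have Fp: "F (p z) = F z" for z
    proof -
      have "tilt V (p z) y = tilt V z y" for y
        using p(3)[of y z] by (simp add: tilt_def indicator_def)
      then show ?thesis
        using p(3)[OF a(1), of z] by (simp add: F_def tilt_mass_def inner_commute)
    qed
    have lower: "(c - norm a) * norm u \<le> F u" if "u \<in> K" for u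
    proof -
      have "c * norm u \<le> (\<integral>y. max 0 (u \<bullet> Y y) \<partial>\<mu>)"
        by (rule c(2)[OF that])
      also have "\<dots> \<le> tilt_mass \<mu> V u"
        unfolding tilt_mass_def
      proof (rule integral_mono)
        show "integrable \<mu> (\<lambda>y. max 0 (u \<bullet> Y y))"
          using intY by (intro integrable_max) auto
        fix y
        have "u \<bullet> y \<le> exp (u \<bullet> y)"
          using exp_ge_add_one_self[of "u \<bullet> y"] by linarith
        then show "max 0 (u \<bullet> Y y) \<le> tilt V u y"
          by (simp add: Y_def tilt_def indicator_def)
      qed (rule integrable_tilt[OF Vm])
      finally show ?thesis
        using norm_cauchy_schwarz[of a u] by (simp add: F_def algebra_simps)
    qed
    have "continuous_on UNIV F"
      unfolding F_def
      by (intro continuous_intros convex_on_continuous convex_tilt_mass Vm) simp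
    \<comment> \<open>Beyond this radius the lower bound exceeds \<open>F 0\<close>, so minimising
      over a ball suffices.\<close>
    define r where "r = F 0 / (c - norm a) + 1"
    have F0: "0 \<le> F 0"
      unfolding F_def tilt_mass_def by (simp add: integral_nonneg_AE)
    then have r: "0 \<le> r" "F 0 < (c - norm a) * r"
      using a(2) by (simp_all add: r_def distrib_left)
    have "0 \<in> K"
      unfolding K_def using linear_0[OF p(1)] by (auto simp: orthant_def intro!: image_eqI[of _ _ 0])
    then have "0 \<in> K \<inter> cball 0 r"
      using r by simp
    moreover have "compact (K \<inter> cball 0 r)"
      using clK by (simp add: closed_Int_compact)
    moreover have "continuous_on (K \<inter> cball 0 r) F"
      using \<open>continuous_on UNIV F\<close> by (rule continuous_on_subset) simp
    ultimately obtain u where u: "u \<in> K \<inter> cball 0 r" "\<And>v. v \<in> K \<inter> cball 0 r \<Longrightarrow> F u \<le> F v"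
      using continuous_attains_inf[of "K \<inter> cball 0 r" F] by blast
    have "F u \<le> F v" if "v \<in> K" for v
    proof (cases "norm v \<le> r")
      case False
      have "F u \<le> F 0"
        using u(2)[OF \<open>0 \<in> K \<inter> cball 0 r\<close>] .
      also have "\<dots> \<le> (c - norm a) * r"
        using r by simp
      also have "\<dots> \<le> (c - norm a) * norm v"
        using False a(2) by (intro mult_left_mono) auto
      also have "\<dots> \<le> F v"
        by (rule lower[OF that])
      finally show ?thesis .
    qed (use u(2) that in auto)
    moreover obtain z where "z \<in> orthant" "u = p z"
      using u(1) by (auto simp: K_def)
    ultimately have "\<forall>w\<in>orthant. F z \<le> F w"
      by (metis Fp K_def imageI)
    then show ?thesis
      using \<open>z \<in> orthant\<close> by (auto simp: F_def)
  qed
  show thesis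
    by (rule that[OF c(1) min])
qed

text \<open>Kuhn-Tucker conditions: along each axis \<open>z\<close> may always be increased, and
  also decreased where \<open>0 < z $ i\<close>. Comparing values up to second order in the
  perturbation gives one or two signs of the partial derivative.\<close>

lemma tilt_moment_at_min:
  assumes V: "V \<in> sets borel" and z: "z \<in> orthant"
    and min: "\<And>w. w \<in> orthant \<Longrightarrow> tilt_mass \<mu> V z - a \<bullet> z \<le> tilt_mass \<mu> V w - a \<bullet> w"
  shows "a $ i \<le> tilt_moment \<mu> V z $ i" "0 < z $ i \<Longrightarrow> tilt_moment \<mu> V z $ i = a $ i"
proof -
  define b where "b = tilt_moment \<mu> V z $ i - a $ i"
  have moment: "tilt_moment \<mu> V z $ i = (\<integral>y. tilt V z y * y $ i \<partial>\<mu>)"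
    using tilt_moment_inner[OF V, of "axis i 1" z] by (simp add: inner_axis')
  have int1: "integrable \<mu> (\<lambda>y. tilt V z y * y $ i)"
    using integrable_inner_right[OF integrable_tilt_moment[OF V, of z], of "axis i 1"]
    by (simp add: inner_axis')
  \<comment> \<open>Integrable coefficient of \<open>t\<^sup>2\<close> in the error of
    \<open>exp_le_quadratic\<close>, valid for all \<open>\<bar>t\<bar> \<le> 1\<close>.\<close>
  define q where "q y = tilt V z y * ((y $ i)\<^sup>2 * exp \<bar>y $ i\<bar>)" for y
  have int2: "integrable \<mu> q"
  proof (rule Bochner_Integration.integrable_bound[OF integrable_mult_right[OF integrable_exp_coordinate]])
    show "q \<in> borel_measurable \<mu>"
      using V unfolding q_def tilt_def by measurable
    show "AE y in \<mu>. norm (q y) \<le> norm (2 * (exp (2 * \<bar>y $ i\<bar>) * exp (z \<bullet> y)))"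
    proof (rule AE_I2)
      fix y :: "real ^ 'n"
      have "(y $ i)\<^sup>2 * exp \<bar>y $ i\<bar> \<le> 2 * exp \<bar>y $ i\<bar> * exp \<bar>y $ i\<bar>"
        by (intro mult_right_mono square_le_exp_abs) simp
      also have "\<dots> = 2 * exp (2 * \<bar>y $ i\<bar>)"
        by (simp add: mult.assoc flip: exp_add)
      finally have "q y \<le> exp (z \<bullet> y) * (2 * exp (2 * \<bar>y $ i\<bar>))"
        unfolding q_def by (rule mult_mono[OF tilt_le_exp]) auto
      then show "norm (q y) \<le> norm (2 * (exp (2 * \<bar>y $ i\<bar>) * exp (z \<bullet> y)))"
        by (simp add: q_def mult_ac)
    qed
  qed
  define C where "C = (\<integral>y. q y \<partial>\<mu>)"
  have C: "0 \<le> C"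
    unfolding C_def q_def by (simp add: integral_nonneg_AE)
  have bound: "0 \<le> t * b + t\<^sup>2 * C" if t: "\<bar>t\<bar> \<le> 1" "z + axis i t \<in> orthant" for t
  proof -
    have "tilt_mass \<mu> V (z + axis i t) \<le> (\<integral>y. tilt V z y + t * (tilt V z y * y $ i) + t\<^sup>2 * q y \<partial>\<mu>)"
      unfolding tilt_mass_def
    proof (rule integral_mono)
      fix y :: "real ^ 'n"
      have "exp (t * y $ i) \<le> 1 + t * y $ i + (t * y $ i)\<^sup>2 * exp \<bar>t * y $ i\<bar>"
        by (rule exp_le_quadratic)
      also have "(t * y $ i)\<^sup>2 * exp \<bar>t * y $ i\<bar> \<le> (t * y $ i)\<^sup>2 * exp \<bar>y $ i\<bar>"
        using mult_right_mono[OF t(1), of "\<bar>y $ i\<bar>"] by (intro mult_left_mono) (auto simp: abs_mult)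
      finally have "exp (t * y $ i) \<le> 1 + t * y $ i + t\<^sup>2 * ((y $ i)\<^sup>2 * exp \<bar>y $ i\<bar>)"
        by (simp add: power_mult_distrib mult_ac)
      then have "tilt V z y * exp (t * y $ i) \<le>
          tilt V z y * (1 + t * y $ i + t\<^sup>2 * ((y $ i)\<^sup>2 * exp \<bar>y $ i\<bar>))"
        by (intro mult_left_mono) auto
      then show "tilt V (z + axis i t) y \<le> tilt V z y + t * (tilt V z y * y $ i) + t\<^sup>2 * q y"
        by (simp add: tilt_add inner_axis' q_def algebra_simps)
    qed (intro Bochner_Integration.integrable_add integrable_mult_right integrable_tilt V int1 int2)+
    also have "\<dots> = tilt_mass \<mu> V z + t * tilt_moment \<mu> V z $ i + t\<^sup>2 * C"
      using int1 int2 integrable_tilt[OF V, of z] by (simp add: tilt_mass_def moment C_def)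
    finally show ?thesis
      using min[OF t(2)] by (simp add: b_def inner_add_right inner_axis algebra_simps)
  qed
  have "0 \<le> b"
  proof (rule nonneg_of_quadratic_bound[OF _ C])
    show "0 \<le> t * b + t\<^sup>2 * C" if "0 < t" "t \<le> 1" for t
      using z that by (intro bound) (auto simp: orthant_def axis_def)
  qed simp
  then show "a $ i \<le> tilt_moment \<mu> V z $ i"
    by (simp add: b_def)
  assume zi: "0 < z $ i"
  have "0 \<le> - b"
  proof (rule nonneg_of_quadratic_bound[OF _ C])
    show "0 < min 1 (z $ i)"
      using zi by simp
    show "0 \<le> t * (- b) + t\<^sup>2 * C" if "0 < t" "t \<le> min 1 (z $ i)" for t
      using bound[of "- t"] z that by (auto simp: orthant_def axis_def)
  qed
  with \<open>0 \<le> b\<close> show "tilt_moment \<mu> V z $ i = a $ i"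
    by (simp add: b_def)
qed

end

subsection \<open>The lower bound\<close>

lemma component_ge_of_norm_le: "norm s \<le> R \<Longrightarrow> - R \<le> (s :: real ^ 'n) $ i"
  using component_le_norm_cart[of s i] by linarith

theorem theorem4:
  fixes \<mu> :: "(real ^ 'n) measure"
  assumes "prob_space \<mu>"
    and "sets \<mu> = sets borel"
    and "\<forall>z. laplace \<mu> z < \<infinity>"
    and "(INF z\<in>orthant. laplace \<mu> z) > 0"
  shows "\<exists>\<delta>\<ge>0. \<forall>\<epsilon>>0. \<exists>R::real. \<forall>x\<in>shifted_orthant \<delta>. boundary_dist \<mu> x \<ge> ereal R \<longrightarrow>
    \<bar>rho \<mu> x - enn2ereal (INF z\<in>orthant. laplace \<mu> z)\<bar> < ereal \<epsilon>"
proof -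
  interpret prob_space \<mu> by fact
  interpret step_law \<mu>
    using assms(2,3) by unfold_locales auto
  define V where "V = reduced_support \<mu>"
  define I where "I = support_axes \<mu>"
  define J where "J = orthogonal_axes \<mu>"
  obtain us where us: "set us \<subseteq> orthant" "V = tuple_flat us (length us)"
    "\<And>k. k < length us \<Longrightarrow> AE y in \<mu>. y \<in> tuple_flat us k \<longrightarrow> us ! k \<bullet> y \<le> 0"
    "\<And>u. u \<in> orthant \<Longrightarrow> u \<notin> orthogonal_comp V \<Longrightarrow> \<not> (AE y in \<mu>. y \<in> V \<longrightarrow> u \<bullet> y \<le> 0)"
    by (rule reduced_support_characterization) (fold V_def, rule that)
  have V: "subspace V"
    unfolding us(2) tuple_flat_length by (rule subspace_orthogonal_comp)
  then have Vm: "V \<in> sets borel"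
    by (intro borel_closed closed_subspace)
  \<comment> \<open>Steps in \<open>V\<close> leave the coordinates in \<open>J\<close> fixed, so no
    distance from those faces is required.\<close>
  have J0: "s $ j = 0" if "s \<in> V" "j \<in> J" for s j
    using that by (auto simp: J_def orthogonal_axes_def V_def orthogonal_comp_def orthogonal_def
        inner_axis)
  obtain ell where ell: "(INF z\<in>orthant. laplace \<mu> z) = ennreal ell" "0 < ell"
  proof (cases "INF z\<in>orthant. laplace \<mu> z")
    case (real r)
    then show ?thesis
      using that[of r] assms(4) by auto
  next
    case top
    have "(0 :: real ^ 'n) \<in> orthant"
      by (simp add: orthant_def)
    then have "(INF z\<in>orthant. laplace \<mu> z) \<le> laplace \<mu> 0"
      by (rule INF_lower)
    with top laplace_finite[of 0] show ?thesis
      by simp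
  qed
  have ell_le: "ell \<le> tilt_mass \<mu> V w" if "w \<in> orthant" for w
    using INF_laplace_le_tilt_mass[OF us(1,3) that] ell unfolding us(2)[symmetric]
    by (cases "0 \<le> tilt_mass \<mu> V w") (auto simp: ennreal_le_iff ennreal_neg)
  have mass: "0 < tilt_mass \<mu> V w" if "w \<in> orthant" for w
    using ell_le[OF that] ell(2) by simp
  obtain c where c: "0 < c" "\<And>a. a \<in> V \<Longrightarrow> norm a < c \<Longrightarrow>
      \<exists>z\<in>orthant. \<forall>w\<in>orthant. tilt_mass \<mu> V z - a \<bullet> z \<le> tilt_mass \<mu> V w - a \<bullet> w"
    by (rule tilt_mass_attains_min[OF V us(4)]) (assumption, assumption, rule that)
  \<comment> \<open>Small enough that the perturbation \<open>a\<close> below has norm less than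
    \<open>c\<close>.\<close>
  define \<kappa> where "\<kappa> = c / (2 * (1 + real CARD('n)))"
  have \<kappa>: "0 < \<kappa>"
    using c(1) by (simp add: \<kappa>_def add_pos_nonneg)
  \<comment> \<open>\<open>u\<close> is the tilt of the initial phase: its mean \<open>m\<close> satisfies \<open>m\<^sub>i > 0\<close> for \<open>i \<in> I\<close>.\<close>
  define a :: "real ^ 'n" where "a = (\<Sum>i\<in>I. \<kappa> *\<^sub>R axis i 1)"
  have ai: "a $ i = (if i \<in> I then \<kappa> else 0)" for i
    by (simp add: a_def axis_def if_distrib cong: if_cong)
  have aV: "a \<in> V"
    unfolding a_def using V
    by (intro subspace_sum subspace_scale) (auto simp: I_def support_axes_def V_def)
  have "norm a \<le> (\<Sum>i\<in>I. norm (\<kappa> *\<^sub>R (axis i 1 :: real ^ 'n)))"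
    unfolding a_def by (rule norm_sum)
  also have "\<dots> = \<kappa> * real (card I)"
    using \<kappa> by simp
  also have "\<dots> \<le> \<kappa> * real CARD('n)"
    using \<kappa> by (intro mult_left_mono) (auto intro: card_mono)
  also have "\<dots> < c"
    using c(1) by (simp add: \<kappa>_def field_simps) (simp add: add_pos_nonneg)
  finally have "norm a < c" .
  from c(2)[OF aV this] obtain u where u: "u \<in> orthant"
    "\<And>w. w \<in> orthant \<Longrightarrow> tilt_mass \<mu> V u - a \<bullet> u \<le> tilt_mass \<mu> V w - a \<bullet> w"
    by blast
  have "0 \<in> V" "norm (0 :: real ^ 'n) < c"
    using V c(1) by (simp_all add: subspace_0)
  from c(2)[OF this] obtain z where z: "z \<in> orthant"
    "\<And>w. w \<in> orthant \<Longrightarrow> tilt_mass \<mu> V z - 0 \<bullet> z \<le> tilt_mass \<mu> V w - 0 \<bullet> w"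
    by blast
  define m where "m = tilt_mean \<mu> V u"
  define k where "k = tilt_mean \<mu> V z"
  define L where "L = tilt_mass \<mu> V z"
  have L: "0 < L"
    unfolding L_def by (rule mass[OF z(1)])
  have mV: "m \<in> V" "k \<in> V"
    unfolding m_def k_def by (rule tilt_mean_mem[OF V])+
  have m0: "0 \<le> m $ i" for i
    using tilt_moment_at_min(1)[OF Vm u, of i] mass[OF u(1)] \<kappa>
    by (auto simp: m_def tilt_mean_def ai split: if_splits)
  have mI: "\<kappa> / tilt_mass \<mu> V u \<le> m $ i" if "i \<in> I" for i
    using tilt_moment_at_min(1)[OF Vm u, of i] mass[OF u(1)] that
    by (auto simp: m_def tilt_mean_def ai divide_right_mono)
  have k0: "0 \<le> k $ i" for i
    using tilt_moment_at_min(1)[OF Vm z, of i] mass[OF z(1)]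
    by (auto simp: k_def tilt_mean_def)
  \<comment> \<open>Complementary slackness: the drift is orthogonal to the tilt, so moving along
    the line costs nothing and the rate is \<open>L\<close> up to the factor
    \<open>1 - e\<close>.\<close>
  have zk: "z \<bullet> k = 0"
  proof -
    have "z $ i * k $ i = 0" for i
    proof (cases "z $ i = 0")
      case False
      then have "0 < z $ i"
        using z(1) by (simp add: orthant_def order_less_le)
      from tilt_moment_at_min(2)[OF Vm z this] show ?thesis
        by (simp add: k_def tilt_mean_def)
    qed simp
    then show ?thesis
      unfolding inner_vec_def by (intro sum.neutral) simp
  qed
  \<comment> \<open>The crude factor 1/2 is paid only over a fixed number of steps. As
    \<open>R0\<close> is obtained before \<epsilon> is given, it can serve as \<delta>.\<close>
  obtain R0 c0 where R0: "0 < R0" and c0: "0 < c0"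
    and tube0: "\<forall>x N n \<gamma>.
      (\<forall>s\<in>V. norm s \<le> R0 \<longrightarrow> \<gamma> \<le> survival \<mu> n (x + real N *\<^sub>R m + s)) \<longrightarrow>
      (\<forall>k\<in>{1..N}. \<forall>s\<in>V. norm s \<le> R0 \<longrightarrow> x + real k *\<^sub>R m + s \<in> orthant) \<longrightarrow>
      ennreal (c0 * (tilt_mass \<mu> V u * (1 - 1 / 2) * exp (- (u \<bullet> m))) ^ N) * \<gamma>
        \<le> survival \<mu> (N + n) x"
    using survival_tube[OF V mass[OF u(1)], of "1 / 2"] unfolding m_def by auto
  define A where "A = tilt_mass \<mu> V u * (1 - 1 / 2) * exp (- (u \<bullet> m))"
  have A: "0 < A"
    using mass[OF u(1)] by (simp add: A_def)
  have "\<exists>R::real. \<forall>x\<in>shifted_orthant R0. boundary_dist \<mu> x \<ge> ereal R \<longrightarrow>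
      \<bar>rho \<mu> x - enn2ereal (INF z\<in>orthant. laplace \<mu> z)\<bar> < ereal \<epsilon>" if \<epsilon>: "0 < \<epsilon>" for \<epsilon> :: real
  proof -
    define e where "e = min 1 (\<epsilon> / (2 * L))"
    have e: "0 < e" "e \<le> 1" "L * e < \<epsilon>"
    proof -
      have "L * e \<le> L * (\<epsilon> / (2 * L))"
        using L by (intro mult_left_mono) (auto simp: e_def)
      then show "L * e < \<epsilon>"
        using L \<epsilon> by simp
    qed (use L \<epsilon> in \<open>auto simp: e_def\<close>)
    define q where "q = L * (1 - e)"
    have q: "0 \<le> q"
      using L e by (simp add: q_def)
    obtain R1 c1 where R1: "0 < R1" and c1: "0 < c1"
      and tube1: "\<forall>x N n \<gamma>.
        (\<forall>s\<in>V. norm s \<le> R1 \<longrightarrow> \<gamma> \<le> survival \<mu> n (x + real N *\<^sub>R k + s)) \<longrightarrow>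
        (\<forall>j\<in>{1..N}. \<forall>s\<in>V. norm s \<le> R1 \<longrightarrow> x + real j *\<^sub>R k + s \<in> orthant) \<longrightarrow>
        ennreal (c1 * (L * (1 - e) * exp (- (z \<bullet> k))) ^ N) * \<gamma> \<le> survival \<mu> (N + n) x"
      using survival_tube[OF V mass[OF z(1)] e(1,2)] unfolding k_def L_def by blast
    have deep: "ennreal (c1 * q ^ n) \<le> survival \<mu> n x"
      if x: "\<And>i. 0 \<le> x $ i" "\<And>i. i \<notin> J \<Longrightarrow> R1 \<le> x $ i" for n x
    proof -
      have "x + real j *\<^sub>R k + s \<in> orthant" if s: "s \<in> V" "norm s \<le> R1" for j s
        unfolding orthant_def
      proof (intro CollectI allI)
        fix i
        have "0 \<le> real j * k $ i"
          using k0 by simp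
        then show "0 \<le> (x + real j *\<^sub>R k + s) $ i"
          using x[of i] component_ge_of_norm_le[OF s(2), of i] J0[OF s(1), of i] by (cases "i \<in> J") auto
      qed
      then have "ennreal (c1 * (L * (1 - e) * exp (- (z \<bullet> k))) ^ n) * 1 \<le> survival \<mu> (n + 0) x"
        by (intro tube1[rule_format]) auto
      then show ?thesis
        by (simp add: zk q_def)
    qed
    \<comment> \<open>Length of the initial phase: it lifts every coordinate in \<open>I\<close> by
      at least \<open>R1\<close> and does not depend on \<open>x\<close>.\<close>
    obtain N :: nat where N: "R1 / (\<kappa> / tilt_mass \<mu> V u) \<le> real N"
      using real_arch_simple by blast
    have Nm: "R1 \<le> real N * m $ i" if "i \<in> I" for i
    proof -
      have "R1 \<le> real N * (\<kappa> / tilt_mass \<mu> V u)"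
        using N \<kappa> mass[OF u(1)] by (simp add: pos_divide_le_eq pos_le_divide_eq)
      also have "\<dots> \<le> real N * m $ i"
        using mI[OF that] by (intro mult_left_mono) auto
      finally show ?thesis .
    qed
    show ?thesis
    \<comment> \<open>The displacement at the end of the initial phase can consume
      \<open>R0\<close>, leaving the distance \<open>R1\<close> that \<open>deep\<close>
      requires.\<close>
    proof (intro exI[of _ "R1 + R0"] ballI impI)
      fix x assume x: "x \<in> shifted_orthant R0" and far: "ereal (R1 + R0) \<le> boundary_dist \<mu> x"
      have xi: "R0 \<le> x $ i" for i
        using x by (simp add: shifted_orthant_def)
      have xf: "R1 + R0 \<le> x $ i" if "i \<notin> I" "i \<notin> J" for i
        using far that by (auto simp: boundary_dist_def le_INF_iff I_def J_def)
      have "ennreal (c0 * A ^ N * c1 * q ^ n) \<le> survival \<mu> (N + n) x" for n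
      proof -
        have "x + real j *\<^sub>R m + s \<in> orthant" if s: "s \<in> V" "norm s \<le> R0" for j s
          unfolding orthant_def
        proof (intro CollectI allI)
          fix i
          have "0 \<le> real j * m $ i"
            using m0 by simp
          then show "0 \<le> (x + real j *\<^sub>R m + s) $ i"
            using xi[of i] component_ge_of_norm_le[OF s(2), of i] by simp
        qed
        moreover have "ennreal (c1 * q ^ n) \<le> survival \<mu> n (x + real N *\<^sub>R m + s)"
          if s: "s \<in> V" "norm s \<le> R0" for s
        proof (rule deep)
          fix i
          have *: "0 \<le> real N * m $ i" "- R0 \<le> s $ i"
            using m0 component_ge_of_norm_le[OF s(2)] by auto
          then show "0 \<le> (x + real N *\<^sub>R m + s) $ i"
            using xi[of i] by simp
          show "R1 \<le> (x + real N *\<^sub>R m + s) $ i" if "i \<notin> J"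
            using xi[of i] xf[OF _ that] Nm[of i] * by (cases "i \<in> I") auto
        qed
        ultimately have "ennreal (c0 * A ^ N) * ennreal (c1 * q ^ n) \<le> survival \<mu> (N + n) x"
          unfolding A_def by (intro tube0[rule_format]) auto
        then show ?thesis
          using c0 A c1 q by (simp add: ennreal_mult mult.assoc)
      qed
      then have lower: "ereal q \<le> rho \<mu> x"
        using c0 c1 A q by (intro rho_ge[of "c0 * A ^ N * c1"]) auto
      have "x \<in> orthant"
        using xi R0 by (auto simp: orthant_def intro: order_trans[of _ R0])
      then have upper: "rho \<mu> x \<le> ereal ell"
        using rho_le_INF_laplace[of x] ell by (simp add: enn2ereal_ennreal)
      obtain r where r: "rho \<mu> x = ereal r"
        using lower upper by (cases "rho \<mu> x") auto
      have "q = L - L * e"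
        by (simp add: q_def algebra_simps)
      \<comment> \<open>This is what makes the tube rate sharp: \<open>q\<close> is at least
        \<open>ell - L * e\<close>, while \<open>upper\<close> bounds the rate by
        \<open>ell\<close>.\<close>
      moreover have "ell \<le> L"
        unfolding L_def by (rule ell_le[OF z(1)])
      ultimately have "\<bar>r - ell\<bar> < \<epsilon>"
        using lower upper e(3) unfolding r by simp
      then show "\<bar>rho \<mu> x - enn2ereal (INF z\<in>orthant. laplace \<mu> z)\<bar> < ereal \<epsilon>"
        using ell by (simp add: r enn2ereal_ennreal)
    qed
  qed
  then show ?thesis
    using R0 by (intro exI[of _ R0]) auto
qed

end
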